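(* There exists a constant $C > 0$ such that, for every $\epsilon > 0$, $$M_{TFL}(\epsilon) \ge e^{\epsilon N_{DFL}(C \epsilon)/C}.$$
   Context: All graphs are finite and simple. Given graphs $G$ and $F$, a map $\phi \colon V(G) \to V(F)$ is an $\epsilon$-approximate homomorphism if at most $\epsilon |V(G)|^2$ edges of $G$ do not map to edges of $F$ under $\phi$. For $\epsilon>0$, $M_{TFL}(\epsilon)$ denotes the smallest integer $M$ such that every triangle-free graph has an $\epsilon$-approximate homomorphism to some triangle-free graph on at most $M$ vertices (such an $M$ exists for every $\epsilon>0$). For $\epsilon>0$, $N_{DFL}(\epsilon)$ denotes the smallest nonnegative integer $N$ such that for every $n \ge N$, every $n$-vertex graph in which each edge lies in a unique triangle has at most $\epsilon n^2$ edges (such an $N$ exists for every $\epsilon>0$). *)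

theory Defs
  imports Complex_Main "HOL-Library.Ramsey"
begin

definition simple_graph :: "'a set \<Rightarrow> 'a set set \<Rightarrow> bool" where
  "simple_graph V E \<longleftrightarrow> finite V \<and> E \<subseteq> [V]\<^bsup>2\<^esup>"

definition triangles :: "'a set \<Rightarrow> 'a set set \<Rightarrow> 'a set set" where
  "triangles V E = {T \<in> [V]\<^bsup>3\<^esup>. [T]\<^bsup>2\<^esup> \<subseteq> E}"

definition triangle_free :: "'a set \<Rightarrow> 'a set set \<Rightarrow> bool" where
  "triangle_free V E \<longleftrightarrow> triangles V E = {}"

definition unique_triangle_edges :: "'a set \<Rightarrow> 'a set set \<Rightarrow> bool" where
  "unique_triangle_edges V E \<longleftrightarrow> (\<forall>e\<in>E. \<exists>!T. T \<in> triangles V E \<and> e \<subseteq> T)"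

(* An edge whose two endpoints are identified by \<phi> has a singleton image,
   which is not an edge of F, so it counts among the badly mapped edges. *)
definition approx_hom ::
  "real \<Rightarrow> 'a set \<Rightarrow> 'a set set \<Rightarrow> 'b set \<Rightarrow> 'b set set \<Rightarrow> ('a \<Rightarrow> 'b) \<Rightarrow> bool" where
  "approx_hom \<epsilon> V\<^sub>G E\<^sub>G V\<^sub>F E\<^sub>F \<phi> \<longleftrightarrow>
     \<phi> ` V\<^sub>G \<subseteq> V\<^sub>F \<and> real (card {e \<in> E\<^sub>G. \<phi> ` e \<notin> E\<^sub>F}) \<le> \<epsilon> * (real (card V\<^sub>G))\<^sup>2"

(* Every finite graph is isomorphic to one whose vertices are natural numbers, so
   in the next two definitions quantifying over graphs on nat covers all finite graphs.
   For \<epsilon> > 0 the minima are attained, so that LEAST denotes them. *)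
definition M_TFL :: "real \<Rightarrow> nat" where
  "M_TFL \<epsilon> = (LEAST M.
     \<forall>(V\<^sub>G :: nat set) E\<^sub>G. simple_graph V\<^sub>G E\<^sub>G \<and> triangle_free V\<^sub>G E\<^sub>G \<longrightarrow>
       (\<exists>(V\<^sub>F :: nat set) E\<^sub>F \<phi>. simple_graph V\<^sub>F E\<^sub>F \<and> triangle_free V\<^sub>F E\<^sub>F \<and> card V\<^sub>F \<le> M \<and>
          approx_hom \<epsilon> V\<^sub>G E\<^sub>G V\<^sub>F E\<^sub>F \<phi>))"

definition N_DFL :: "real \<Rightarrow> nat" where
  "N_DFL \<epsilon> = (LEAST N.
     \<forall>n\<ge>N. \<forall>(V :: nat set) E.
       simple_graph V E \<and> card V = n \<and> unique_triangle_edges V E \<longrightarrow>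
       real (card E) \<le> \<epsilon> * (real n)\<^sup>2)"

end

theory Submission
  imports Defs
begin

text \<open>Let \<open>(V, E)\<close> be a graph on \<open>n\<close> vertices with more than \<open>C * \<epsilon> * n\<^sup>2\<close> edges, each in a unique triangle,
and let \<open>T\<close> be its set of triangles, so that there are more than \<open>C * \<epsilon> * n\<^sup>2 / 3\<close> of them. Replace each vertex by
a copy of the discrete cube whose coordinates are indexed by \<open>T\<close>, and each triangle \<open>t = {x, y, z}\<close>
by three complete bipartite graphs between halves of the cubes over \<open>x\<close>, \<open>y\<close>, \<open>z\<close>, the halves being
given by the coordinate \<open>t\<close>, in such a way that over each vertex the two halves in use are opposite.
The resulting graph is triangle-free (\<open>triangle_free_split\<close>).

Consider an \<open>\<epsilon>\<close>-approximate homomorphism from this graph to a triangle-free graph on at most \<open>M\<close> vertices. It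
partitions each cube into at most \<open>M\<close> classes. Such a partition can carry information about \<open>O(log M)\<close>
coordinates only (\<open>card_determined_le\<close>). If the coordinate \<open>t\<close> is balanced within most classes
over each of \<open>x\<close>, \<open>y\<close>, \<open>z\<close>, the opposite halves become indistinguishable for the target graph, which would
have a triangle unless a constant proportion of the edges for \<open>t\<close> were lost
(\<open>lost_in_triangle\<close>). As at most \<open>\<epsilon> * n\<^sup>2\<close> times the squared size of the cube edges are lost, only
\<open>O(\<epsilon> * n\<^sup>2)\<close> triangles can be of this kind. All others are among the \<open>O(n * log M)\<close> triangles that are determined at one of
their vertices. So if \<open>C\<close> is large, \<open>log M\<close> is at least a constant multiple of \<open>\<epsilon> * n\<close>
(\<open>unique_triangle_edge_bound\<close>).

This applies to the least \<open>M\<close> with the required property, provided that some \<open>M\<close> has it. That is the triangle-free lemma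
(\<open>ex_TFL_bound\<close>), proved by a one-sided form of Szemeredi's regularity method: an energy increment yields a
partition of the vertices in which almost all edges are in sparse or in uniformly dense pairs of parts, and uniform
density of all pairs among three parts forces a triangle.\<close>

section \<open>Averages over the fibres of a map\<close>

text \<open>The conditional expectation of \<open>f\<close> given \<open>p\<close>, under counting measure on the finite set
\<open>\<Omega>\<close>.\<close>

definition cond_avg :: "'a set \<Rightarrow> ('a \<Rightarrow> 'c) \<Rightarrow> ('a \<Rightarrow> real) \<Rightarrow> 'a \<Rightarrow> real" where
  "cond_avg \<Omega> p f w = (\<Sum>w'\<in>{w'\<in>\<Omega>. p w' = p w}. f w') / real (card {w'\<in>\<Omega>. p w' = p w})"

lemma sum_mono_fibrewise:
  fixes u v :: "'a \<Rightarrow> real"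
  assumes "finite \<Omega>"
    and "\<And>w. w \<in> \<Omega> \<Longrightarrow> (\<Sum>w'\<in>{w'\<in>\<Omega>. p w' = p w}. u w') \<le> (\<Sum>w'\<in>{w'\<in>\<Omega>. p w' = p w}. v w')"
  shows "(\<Sum>w\<in>\<Omega>. u w) \<le> (\<Sum>w\<in>\<Omega>. v w)"
proof -
  have "sum u \<Omega> = (\<Sum>y\<in>p ` \<Omega>. sum u {x \<in> \<Omega>. p x = y})"
    using sum.image_gen[OF assms(1)] .
  also have "\<dots> \<le> (\<Sum>y\<in>p ` \<Omega>. sum v {x \<in> \<Omega>. p x = y})"
    by (rule sum_mono) (use assms(2) in auto)
  also have "\<dots> = sum v \<Omega>"
    using sum.image_gen[OF assms(1), symmetric] .
  finally show ?thesis .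
qed

lemma cond_avg_cong: "p w = p w' \<Longrightarrow> cond_avg \<Omega> p f w = cond_avg \<Omega> p f w'"
  by (simp add: cond_avg_def)

text \<open>The defining property of a conditional expectation: it cannot be told apart from \<open>f\<close> by any
weight that \<open>p\<close> determines.\<close>

lemma sum_cond_avg_mult:
  assumes fin: "finite \<Omega>"
    and g: "\<And>w w'. w \<in> \<Omega> \<Longrightarrow> w' \<in> \<Omega> \<Longrightarrow> p w = p w' \<Longrightarrow> g w = g w'"
  shows "(\<Sum>w\<in>\<Omega>. cond_avg \<Omega> p f w * g w) = (\<Sum>w\<in>\<Omega>. f w * g w)"
proof -
  have fib: "(\<Sum>w'\<in>{w'\<in>\<Omega>. p w' = p w}. cond_avg \<Omega> p f w' * g w')
      = (\<Sum>w'\<in>{w'\<in>\<Omega>. p w' = p w}. f w' * g w')" if "w \<in> \<Omega>" for w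
  proof -
    let ?F = "{w'\<in>\<Omega>. p w' = p w}"
    have c: "real (card ?F) \<noteq> 0" using fin that by auto
    have "(\<Sum>w'\<in>?F. cond_avg \<Omega> p f w' * g w') = (\<Sum>w'\<in>?F. cond_avg \<Omega> p f w * g w)"
    proof (rule sum.cong)
      fix w' assume "w' \<in> ?F"
      then have "g w' = g w" "cond_avg \<Omega> p f w' = cond_avg \<Omega> p f w"
        using g that by (blast, metis (mono_tags, lifting) cond_avg_cong mem_Collect_eq)
      then show "cond_avg \<Omega> p f w' * g w' = cond_avg \<Omega> p f w * g w" by simp
    qed simp
    also have "\<dots> = real (card ?F) * (cond_avg \<Omega> p f w * g w)" by simp
    also have "\<dots> = (\<Sum>w'\<in>?F. f w') * g w" using c by (simp add: cond_avg_def)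
    also have "\<dots> = (\<Sum>w'\<in>?F. f w' * g w')"
      unfolding sum_distrib_right
    proof (rule sum.cong)
      fix w' assume "w' \<in> ?F"
      then have "g w' = g w" using g that by blast
      then show "f w' * g w = f w' * g w'" by simp
    qed simp
    finally show ?thesis .
  qed
  show ?thesis
    by (rule antisym; rule sum_mono_fibrewise[OF fin, where p=p]) (use fib in auto)
qed

text \<open>Averaging over fibres is the orthogonal projection onto the functions that \<open>p\<close> determines.
If \<open>q\<close> refines \<open>p\<close>, the two projections are nested, whence the orthogonality of
the average over \<open>p\<close> and the difference of the two averages.\<close>

lemma cond_avg_pythagoras:
  assumes fin: "finite \<Omega>" and ref: "\<And>w w'. q w = q w' \<Longrightarrow> p w = p w'"
  shows "(\<Sum>w\<in>\<Omega>. (cond_avg \<Omega> q f w)\<^sup>2) =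
    (\<Sum>w\<in>\<Omega>. (cond_avg \<Omega> p f w)\<^sup>2) + (\<Sum>w\<in>\<Omega>. (cond_avg \<Omega> q f w - cond_avg \<Omega> p f w)\<^sup>2)"
proof -
  let ?P = "cond_avg \<Omega> p f" and ?Q = "cond_avg \<Omega> q f"
  have "(\<Sum>w\<in>\<Omega>. ?Q w * ?P w) = (\<Sum>w\<in>\<Omega>. f w * ?P w)"
    by (rule sum_cond_avg_mult[OF fin]) (metis ref cond_avg_cong)
  also have "\<dots> = (\<Sum>w\<in>\<Omega>. ?P w * ?P w)"
    by (rule sum_cond_avg_mult[OF fin, symmetric]) (metis cond_avg_cong)
  finally have *: "(\<Sum>w\<in>\<Omega>. ?Q w * ?P w) = (\<Sum>w\<in>\<Omega>. ?P w * ?P w)" .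
  have "(\<Sum>w\<in>\<Omega>. (?Q w - ?P w)\<^sup>2) =
      (\<Sum>w\<in>\<Omega>. (?Q w)\<^sup>2) - 2 * (\<Sum>w\<in>\<Omega>. ?Q w * ?P w) + (\<Sum>w\<in>\<Omega>. (?P w)\<^sup>2)"
    by (simp add: power2_diff sum.distrib sum_subtractf sum_distrib_left algebra_simps)
  then show ?thesis unfolding * by (simp add: power2_eq_square)
qed

section \<open>Uniformly dense pairs of vertex sets\<close>

definition adj :: "'a set set \<Rightarrow> 'a \<times> 'a \<Rightarrow> real" where
  "adj E w = of_bool ({fst w, snd w} \<in> E)"

definition edge_count :: "'a set set \<Rightarrow> 'a set \<Rightarrow> 'a set \<Rightarrow> real" where
  "edge_count E A B = (\<Sum>w\<in>A \<times> B. adj E w)"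

text \<open>The half of epsilon-regularity that is needed to find triangles: no large subpair is sparse.
A pair may violate it for two reasons, by being sparse itself or by being irregular, and these are
treated separately later on.\<close>

definition unif_dense :: "'a set set \<Rightarrow> real \<Rightarrow> 'a set \<Rightarrow> 'a set \<Rightarrow> bool" where
  "unif_dense E \<delta> A B \<longleftrightarrow> (\<forall>A'\<subseteq>A. \<forall>B'\<subseteq>B. \<delta> * card A \<le> card A' \<and> \<delta> * card B \<le> card B' \<longrightarrow>
     \<delta> * (real (card A') * real (card B')) \<le> edge_count E A' B')"

lemma edge_count_commute: "edge_count E A B = edge_count E B A"
  unfolding edge_count_def adj_def
  by (rule sum.reindex_bij_witness[where i=prod.swap and j=prod.swap]) (auto simp: insert_commute)

lemma unif_dense_commute: "unif_dense E \<delta> A B = unif_dense E \<delta> B A"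
  unfolding unif_dense_def by (metis edge_count_commute mult.commute)

lemma edge_count_eq:
  assumes "finite A" "finite B"
  shows "edge_count E A B = (\<Sum>a\<in>A. real (card {b\<in>B. {a,b} \<in> E}))"
proof -
  have "edge_count E A B = (\<Sum>a\<in>A. \<Sum>b\<in>B. of_bool ({a,b} \<in> E))"
    unfolding edge_count_def adj_def by (simp add: sum.cartesian_product case_prod_beta)
  also have "\<dots> = (\<Sum>a\<in>A. real (card {b\<in>B. {a,b} \<in> E}))"
    using assms by (simp add: Int_def sum_of_bool_eq)
  finally show ?thesis .
qed

text \<open>The vertices of low degree would otherwise form, together with \<open>X\<close>, a sparse subpair.\<close>

lemma few_low_degree:
  assumes fin: "finite A" "finite X" and ne: "A \<noteq> {}" "X \<noteq> {}"
    and d: "0 < \<delta>" "\<delta> \<le> 1" and D: "unif_dense E \<delta> A X"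
  shows "real (card {a\<in>A. real (card {b\<in>X. {a,b} \<in> E}) < \<delta> * card X}) < \<delta> * card A"
proof (rule ccontr)
  let ?L = "{a\<in>A. real (card {b\<in>X. {a,b} \<in> E}) < \<delta> * card X}"
  assume "\<not> ?thesis"
  then have big: "\<delta> * card A \<le> card ?L" by simp
  have "\<delta> * card A > 0" using d fin ne by (simp add: card_gt_0_iff)
  with big have "?L \<noteq> {}" by (metis card.empty of_nat_0 not_le)
  have "\<delta> * (real (card ?L) * real (card X)) \<le> edge_count E ?L X"
    using D big d unfolding unif_dense_def
    by (auto simp: mult_left_le_one_le)
  also have "\<dots> = (\<Sum>a\<in>?L. real (card {b\<in>X. {a,b} \<in> E}))"
    using fin by (intro edge_count_eq) auto
  also have "\<dots> < (\<Sum>a\<in>?L. \<delta> * card X)"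
    using \<open>?L \<noteq> {}\<close> fin by (intro sum_strict_mono) auto
  finally show False by (simp add: mult_ac)
qed

text \<open>Because the exceptional sets of vertices with few neighbours in \<open>B\<close> or in \<open>C\<close> do not cover
\<open>A\<close>, some vertex of \<open>A\<close> has large neighbourhoods in both, and there is an edge between these.
The sets may coincide: with \<open>A = B = C\<close> this says that in a
triangle-free graph no nonempty set forms a uniformly dense pair with itself. This is why edges inside a part
of a partition need no special treatment.\<close>

lemma unif_dense_triangle:
  assumes fin: "finite A" "finite B" "finite C" and ne: "A \<noteq> {}" "B \<noteq> {}" "C \<noteq> {}"
    and d: "0 < \<delta>" "\<delta> \<le> 1/2"
    and D: "unif_dense E \<delta> A B" "unif_dense E \<delta> A C" "unif_dense E \<delta> B C"
  shows "\<exists>a\<in>A. \<exists>b\<in>B. \<exists>c\<in>C. {a,b} \<in> E \<and> {a,c} \<in> E \<and> {b,c} \<in> E"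
proof -
  define L where "L X = {a\<in>A. real (card {b\<in>X. {a,b} \<in> E}) < \<delta> * card X}" for X
  have "real (card (L B)) < \<delta> * card A" "real (card (L C)) < \<delta> * card A"
    unfolding L_def using assms by (auto intro!: few_low_degree)
  moreover have "\<delta> * card A \<le> 1/2 * card A" using d by (intro mult_right_mono) auto
  ultimately have "card (L B) + card (L C) < card A" by linarith
  then have "card (L B \<union> L C) < card A" using card_Un_le[of "L B" "L C"] by linarith
  moreover have "L B \<union> L C \<subseteq> A" by (auto simp: L_def)
  ultimately obtain a where a: "a \<in> A" "a \<notin> L B" "a \<notin> L C" by (metis UnCI less_irrefl subsetI subset_antisym)
  define NB where "NB = {b\<in>B. {a,b} \<in> E}"
  define NC where "NC = {b\<in>C. {a,b} \<in> E}"
  have big: "\<delta> * card B \<le> card NB" "\<delta> * card C \<le> card NC" using a by (auto simp: L_def NB_def NC_def)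
  moreover have "NB \<subseteq> B" "NC \<subseteq> C" by (auto simp: NB_def NC_def)
  ultimately have ec: "\<delta> * (real (card NB) * real (card NC)) \<le> edge_count E NB NC"
    using D(3) unfolding unif_dense_def by blast
  have "\<delta> * card B > 0" "\<delta> * card C > 0" using d fin ne by (simp_all add: card_gt_0_iff)
  then have "edge_count E NB NC > 0" using big ec d by (smt (verit) mult_pos_pos)
  then obtain w where "w \<in> NB \<times> NC" "adj E w \<noteq> 0" unfolding edge_count_def
    by (metis less_irrefl sum.neutral)
  then show ?thesis using a by (fastforce simp: adj_def NB_def NC_def)
qed

section \<open>Partitions with few irregular pairs\<close>

text \<open>A partition of the vertices is represented by a finite family \<open>S\<close> of sets, its parts being the
nonempty atoms of \<open>S\<close>. Refining a partition is then just enlarging the family, and the number of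
parts is bounded through the cardinality of the family.\<close>

definition label :: "'a set set \<Rightarrow> 'a \<Rightarrow> 'a set set" where
  "label S x = {A\<in>S. x \<in> A}"

definition lab2 :: "'a set set \<Rightarrow> 'a \<times> 'a \<Rightarrow> 'a set set \<times> 'a set set" where
  "lab2 S w = (label S (fst w), label S (snd w))"

definition cell :: "'a set \<Rightarrow> 'a set set \<Rightarrow> 'a set set \<Rightarrow> 'a set" where
  "cell V S i = {y\<in>V. label S y = i}"

definition density :: "'a set \<Rightarrow> 'a set set \<Rightarrow> 'a set set \<Rightarrow> 'a \<times> 'a \<Rightarrow> real" where
  "density V E S = cond_avg (V \<times> V) (lab2 S) (adj E)"

definition irregular :: "'a set \<Rightarrow> 'a set set \<Rightarrow> real \<Rightarrow> 'a set set \<Rightarrow> ('a \<times> 'a) set" where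
  "irregular V E \<delta> S = {w\<in>V \<times> V. 2 * \<delta> \<le> density V E S w \<and>
     \<not> unif_dense E \<delta> (cell V S (label S (fst w))) (cell V S (label S (snd w)))}"

definition energy :: "'a set \<Rightarrow> 'a set set \<Rightarrow> 'a set set \<Rightarrow> real" where
  "energy V E S = (\<Sum>w\<in>V \<times> V. (density V E S w)\<^sup>2)"

lemma lab2_fibre:
  "{w'\<in>V \<times> V. lab2 S w' = lab2 S w} = cell V S (label S (fst w)) \<times> cell V S (label S (snd w))"
  by (auto simp: lab2_def cell_def)

lemma density_bounds:
  assumes "finite V" shows "0 \<le> density V E S w" "density V E S w \<le> 1"
proof -
  let ?F = "{w'\<in>V \<times> V. lab2 S w' = lab2 S w}"
  have "(\<Sum>w'\<in>?F. adj E w') \<le> (\<Sum>w'\<in>?F. 1)" by (rule sum_mono) (auto simp: adj_def)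
  then have "(\<Sum>w'\<in>?F. adj E w') \<le> card ?F" by simp
  moreover have "0 \<le> (\<Sum>w'\<in>?F. adj E w')" by (rule sum_nonneg) (auto simp: adj_def)
  ultimately show "0 \<le> density V E S w" "density V E S w \<le> 1"
    unfolding density_def cond_avg_def by (auto intro: divide_le_eq_1[THEN iffD2] simp: divide_le_eq_1)
qed

lemma energy_le:
  assumes "finite V" shows "energy V E S \<le> (real (card V))\<^sup>2"
proof -
  have "energy V E S \<le> (\<Sum>w\<in>V \<times> V. 1)" unfolding energy_def
    by (rule sum_mono) (use density_bounds[OF assms] in \<open>auto intro: power_le_one\<close>)
  then show ?thesis by (simp add: card_cartesian_product power2_eq_square)
qed

lemma card_label_image_le: "finite S \<Longrightarrow> card (label S ` V) \<le> 2 ^ card S"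
  by (metis (no_types, lifting) card_Pow card_mono finite_Pow_iff image_subsetI label_def Pow_iff mem_Collect_eq subsetI)

text \<open>Add to \<open>S\<close>, for each pair of parts that is not uniformly dense, the two sets that witness this.
On the product of the witnesses for an irregular pair, the density relative to the old partition is
at least \<open>2 * \<delta>\<close>, while the density relative to the new one is less than \<open>\<delta>\<close> on average. By
Pythagoras each irregular pair of parts thus contributes at least \<open>\<delta>\<^sup>2\<close> times the size of the product of the
witnesses, which itself is a proportion \<open>\<delta>\<^sup>2\<close> of the product of the parts.\<close>

lemma energy_increment:
  assumes fV: "finite V" and fS: "finite S" and d: "0 < \<delta>"
  shows "\<exists>S'. finite S' \<and> card S' \<le> card S + 2 * 4 ^ card S \<and>
    energy V E S + \<delta> ^ 4 * card (irregular V E \<delta> S) \<le> energy V E S'"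
proof -
  define Q where "Q i j A B \<longleftrightarrow> A \<subseteq> cell V S i \<and> B \<subseteq> cell V S j \<and>
      \<delta> * card (cell V S i) \<le> card A \<and> \<delta> * card (cell V S j) \<le> card B \<and>
      edge_count E A B < \<delta> * (real (card A) * real (card B))" for i j A B
  \<comment> \<open>For pairs without a witness the choice is arbitrary; it refines the partition without harm.\<close>
  define W where "W i j = (SOME P. Q i j (fst P) (snd P))" for i j
  define W1 where "W1 i j = fst (W i j)" for i j
  define W2 where "W2 i j = snd (W i j)" for i j
  have W: "Q i j (W1 i j) (W2 i j)" if "\<not> unif_dense E \<delta> (cell V S i) (cell V S j)" for i j
  proof -
    have "\<exists>A B. Q i j A B"
    proof (rule ccontr)
      assume none: "\<nexists>A B. Q i j A B"
      have "unif_dense E \<delta> (cell V S i) (cell V S j)"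
        unfolding unif_dense_def
      proof (intro allI impI)
        fix A B assume "A \<subseteq> cell V S i" "B \<subseteq> cell V S j"
          "\<delta> * card (cell V S i) \<le> card A \<and> \<delta> * card (cell V S j) \<le> card B"
        moreover have "\<not> Q i j A B" using none by simp
        ultimately show "\<delta> * (real (card A) * real (card B)) \<le> edge_count E A B"
          unfolding Q_def by linarith
      qed
      then show False using that by simp
    qed
    then have "\<exists>P. Q i j (fst P) (snd P)" by simp
    then have "Q i j (fst (W i j)) (snd (W i j))" unfolding W_def by (rule someI_ex)
    then show ?thesis by (simp add: W1_def W2_def)
  qed
  let ?P = "Pow S \<times> Pow S"
  define S' where "S' = S \<union> (case_prod W1 ` ?P \<union> case_prod W2 ` ?P)"
  have cP: "card ?P = 4 ^ card S" using fS
    by (simp add: card_cartesian_product card_Pow power_mult_distrib[symmetric])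
  have fP: "finite ?P" using fS by simp
  have "card S' \<le> card S + (card (case_prod W1 ` ?P) + card (case_prod W2 ` ?P))"
    unfolding S'_def by (intro order_trans[OF card_Un_le] add_left_mono card_Un_le)
  also have "\<dots> \<le> card S + (card ?P + card ?P)"
    by (intro add_mono card_image_le fP) simp
  finally have cS': "card S' \<le> card S + 2 * 4 ^ card S" using cP by simp
  have fS': "finite S'" using fS unfolding S'_def by auto
  have SS': "S \<subseteq> S'" by (auto simp: S'_def)
  have ref: "lab2 S' w = lab2 S' w' \<Longrightarrow> lab2 S w = lab2 S w'" for w w'
  proof -
    assume "lab2 S' w = lab2 S' w'"
    moreover have "label S x = label S' x \<inter> S" for x using SS' by (auto simp: label_def)
    ultimately show ?thesis by (simp add: lab2_def)
  qed
  let ?Om = "V \<times> V"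
  have fOm: "finite ?Om" using fV by simp
  let ?z = "\<lambda>w. density V E S' w - density V E S w"
  have pyth: "energy V E S' = energy V E S + (\<Sum>w\<in>?Om. (?z w)\<^sup>2)"
    unfolding energy_def density_def by (rule cond_avg_pythagoras[OF fOm]) (rule ref)
  have "(\<Sum>w\<in>?Om. \<delta> ^ 4 * of_bool (w \<in> irregular V E \<delta> S)) \<le> (\<Sum>w\<in>?Om. (?z w)\<^sup>2)"
  proof (rule sum_mono_fibrewise[OF fOm, where p="lab2 S"])
    fix w assume w: "w \<in> ?Om"
    let ?F = "{w'\<in>?Om. lab2 S w' = lab2 S w}"
    define i where "i = label S (fst w)"
    define j where "j = label S (snd w)"
    have F: "?F = cell V S i \<times> cell V S j" unfolding i_def j_def by (rule lab2_fibre)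
    have dens: "density V E S w' = density V E S w" if "w' \<in> ?F" for w'
      using that unfolding density_def by (intro cond_avg_cong) auto
    show "(\<Sum>w'\<in>?F. \<delta> ^ 4 * of_bool (w' \<in> irregular V E \<delta> S)) \<le> (\<Sum>w'\<in>?F. (?z w')\<^sup>2)"
    proof (cases "w \<in> irregular V E \<delta> S")
      case False
      have "w' \<notin> irregular V E \<delta> S" if "w' \<in> ?F" for w'
        using False w dens[OF that] that by (auto simp: irregular_def lab2_def)
      then have "(\<Sum>w'\<in>?F. \<delta> ^ 4 * of_bool (w' \<in> irregular V E \<delta> S)) = 0"
        by (intro sum.neutral) auto
      then show ?thesis by (simp add: sum_nonneg)
    next
      case True
      then have dw: "2 * \<delta> \<le> density V E S w" and nd: "\<not> unif_dense E \<delta> (cell V S i) (cell V S j)"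
        by (auto simp: irregular_def i_def j_def)
      define A where "A = W1 i j"
      define B where "B = W2 i j"
      have AB: "A \<subseteq> cell V S i" "B \<subseteq> cell V S j" "\<delta> * card (cell V S i) \<le> card A"
        "\<delta> * card (cell V S j) \<le> card B"
        and ec: "edge_count E A B < \<delta> * (real (card A) * real (card B))"
        using W[OF nd] by (auto simp: A_def B_def Q_def)
      have "i \<in> Pow S" "j \<in> Pow S" by (auto simp: i_def j_def label_def)
      then have inS': "A \<in> S'" "B \<in> S'" unfolding S'_def A_def B_def by force+
      have sub: "A \<times> B \<subseteq> ?F" "A \<times> B \<subseteq> ?Om" using AB unfolding F by (auto simp: cell_def)
      have fF: "finite ?F" using fOm by simp
      have fAB: "finite (A \<times> B)" using sub(1) fF by (rule finite_subset)
      have mem: "w1 \<in> A \<times> B \<longleftrightarrow> w2 \<in> A \<times> B" if "lab2 S' w1 = lab2 S' w2" for w1 w2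
      proof -
        have "label S' (fst w1) = label S' (fst w2)" "label S' (snd w1) = label S' (snd w2)"
          using that by (auto simp: lab2_def)
        then have "fst w1 \<in> A \<longleftrightarrow> fst w2 \<in> A" "snd w1 \<in> B \<longleftrightarrow> snd w2 \<in> B"
          using inS' unfolding label_def by blast+
        then show ?thesis by (simp add: mem_Times_iff)
      qed
      have ind: "(\<Sum>w'\<in>?Om. h w' * of_bool (w' \<in> A \<times> B)) = (\<Sum>w'\<in>A \<times> B. h w')" for h :: "'a \<times> 'a \<Rightarrow> real"
      proof -
        have "(\<Sum>w'\<in>A \<times> B. h w') = (\<Sum>w'\<in>A \<times> B. h w' * of_bool (w' \<in> A \<times> B))" by simp
        also have "\<dots> = (\<Sum>w'\<in>?Om. h w' * of_bool (w' \<in> A \<times> B))"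
          by (rule sum.mono_neutral_left[OF fOm sub(2)]) auto
        finally show ?thesis by simp
      qed
      have s1: "(\<Sum>w'\<in>A \<times> B. density V E S' w') = edge_count E A B"
      proof -
        have "(\<Sum>w'\<in>?Om. density V E S' w' * of_bool (w' \<in> A \<times> B))
            = (\<Sum>w'\<in>?Om. adj E w' * of_bool (w' \<in> A \<times> B))"
          unfolding density_def by (rule sum_cond_avg_mult[OF fOm]) (rule arg_cong[where f=of_bool], rule mem)
        then show ?thesis unfolding ind edge_count_def .
      qed
      have s2: "(\<Sum>w'\<in>A \<times> B. density V E S w') = card (A \<times> B) * density V E S w"
      proof -
        have "(\<Sum>w'\<in>A \<times> B. density V E S w') = (\<Sum>w'\<in>A \<times> B. density V E S w)"
          by (rule sum.cong) (use dens sub(1) in auto)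
        then show ?thesis by simp
      qed
      let ?ab = "real (card A) * real (card B)"
      have "card (A \<times> B) * density V E S w \<ge> ?ab * (2 * \<delta>)"
        using dw by (simp add: card_cartesian_product mult_left_mono)
      then have zsum: "(\<Sum>w'\<in>A \<times> B. ?z w') \<le> - \<delta> * ?ab"
        unfolding sum_subtractf s1 s2 using ec by (simp add: algebra_simps)
      have affine: "(\<Sum>w'\<in>X. c * h w' - e) = c * sum h X - e * real (card X)"
        for c e :: real and h and X :: "('a \<times> 'a) set"
        by (simp add: sum_subtractf sum_distrib_left)
      have "(\<Sum>w'\<in>?F. \<delta> ^ 4 * of_bool (w' \<in> irregular V E \<delta> S)) \<le> (\<Sum>w'\<in>?F. \<delta> ^ 4)"
        by (rule sum_mono) auto
      also have "\<dots> = \<delta>\<^sup>2 * ((\<delta> * card (cell V S i)) * (\<delta> * card (cell V S j)))"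
        unfolding F by (simp add: card_cartesian_product power2_eq_square power4_eq_xxxx)
      also have "\<dots> \<le> \<delta>\<^sup>2 * ?ab"
        using AB d by (intro mult_left_mono mult_mono) auto
      also have "\<dots> = - 2 * \<delta> * (- \<delta> * ?ab) - \<delta>\<^sup>2 * ?ab" by (simp add: power2_eq_square)
      also have "\<dots> \<le> - 2 * \<delta> * (\<Sum>w'\<in>A \<times> B. ?z w') - \<delta>\<^sup>2 * ?ab"
        using mult_left_mono[OF zsum, of "2 * \<delta>"] d by linarith
      also have "\<dots> = (\<Sum>w'\<in>A \<times> B. - 2 * \<delta> * ?z w' - \<delta>\<^sup>2)"
        using affine[of "- 2 * \<delta>" ?z "\<delta>\<^sup>2" "A \<times> B"] by (simp add: card_cartesian_product)
      also have "\<dots> \<le> (\<Sum>w'\<in>A \<times> B. (?z w')\<^sup>2)"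
      proof (rule sum_mono)
        fix w'
        \<comment> \<open>The tangent to the square at \<open>- \<delta>\<close>, which replaces an appeal to the Cauchy-Schwarz inequality.\<close>
        have "- 2 * \<delta> * t - \<delta>\<^sup>2 \<le> t\<^sup>2" for t :: real
          using zero_le_power2[of "t + \<delta>"] by (simp add: power2_sum algebra_simps)
        then show "- 2 * \<delta> * ?z w' - \<delta>\<^sup>2 \<le> (?z w')\<^sup>2" .
      qed
      also have "\<dots> \<le> (\<Sum>w'\<in>?F. (?z w')\<^sup>2)"
        by (rule sum_mono2[OF fF sub(1)]) simp
      finally show ?thesis .
    qed
  qed
  moreover have "(\<Sum>w\<in>?Om. \<delta> ^ 4 * of_bool (w \<in> irregular V E \<delta> S)) = \<delta> ^ 4 * card (irregular V E \<delta> S)"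
  proof -
    have "?Om \<inter> irregular V E \<delta> S = irregular V E \<delta> S" by (auto simp: irregular_def)
    then show ?thesis using fOm by (simp add: sum_distrib_left[symmetric])
  qed
  ultimately show ?thesis using pyth fS' cS' by (intro exI[of _ S']) auto
qed

text \<open>A bound for the size of the family \<open>S\<close> after \<open>k\<close> rounds of \<open>energy_increment\<close>.\<close>

fun complexity_bound :: "nat \<Rightarrow> nat" where
  "complexity_bound 0 = 0"
| "complexity_bound (Suc k) = complexity_bound k + 2 * 4 ^ complexity_bound k"

text \<open>The energy starts at a nonnegative value, never exceeds the squared number of vertices, and grows by
a proportion \<open>\<delta> ^ 5\<close> of that square as long as the irregular pairs are numerous.\<close>

lemma few_irregular_pairs:
  fixes V :: "'a set"
  assumes fV: "finite V" and d: "0 < \<delta>" and k: "1 < real k * \<delta> ^ 5"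
  shows "\<exists>S. finite S \<and> card S \<le> complexity_bound k \<and>
    card (irregular V E \<delta> S) \<le> \<delta> * (real (card V))\<^sup>2"
proof (cases "V = {}")
  case True
  then have "irregular V E \<delta> {} = {}" by (simp add: irregular_def)
  then show ?thesis by (intro exI[of _ "{}"]) (simp add: d less_imp_le)
next
  case False
  let ?n2 = "(real (card V))\<^sup>2"
  have n2: "?n2 > 0" using False fV by simp
  have step: "(\<exists>S. finite S \<and> card S \<le> complexity_bound j \<and> card (irregular V E \<delta> S) \<le> \<delta> * ?n2)
    \<or> (\<exists>S. finite S \<and> card S \<le> complexity_bound j \<and> real j * \<delta> ^ 5 * ?n2 \<le> energy V E S)" for j
  proof (induction j)
    case 0
    have "energy V E {} \<ge> 0" unfolding energy_def by (rule sum_nonneg) simp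
    then show ?case by (intro disjI2 exI[of _ "{}"]) simp
  next
    case (Suc j)
    from Suc.IH show ?case
    proof (elim disjE exE conjE)
      fix S assume "finite S" "card S \<le> complexity_bound j" "card (irregular V E \<delta> S) \<le> \<delta> * ?n2"
      then show ?thesis by (intro disjI1 exI[of _ S]) simp
    next
      fix S :: "'a set set"
      assume S: "finite S" "card S \<le> complexity_bound j" "real j * \<delta> ^ 5 * ?n2 \<le> energy V E S"
      show ?thesis
      proof (cases "card (irregular V E \<delta> S) \<le> \<delta> * ?n2")
        case True
        then show ?thesis using S by (intro disjI1 exI[of _ S]) simp
      next
        case False
        obtain S' where S': "finite S'" "card S' \<le> card S + 2 * 4 ^ card S"
          "energy V E S + \<delta> ^ 4 * card (irregular V E \<delta> S) \<le> energy V E S'"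
          using energy_increment[OF fV S(1) d] by blast
        have "(4::nat) ^ card S \<le> 4 ^ complexity_bound j" using S(2) by (intro power_increasing) auto
        then have c: "card S' \<le> complexity_bound (Suc j)"
          unfolding complexity_bound.simps using S'(2) S(2) by linarith
        have "\<delta> ^ 4 * (\<delta> * ?n2) \<le> \<delta> ^ 4 * card (irregular V E \<delta> S)"
          using False d by (intro mult_left_mono) auto
        moreover have "\<delta> ^ 4 * (\<delta> * ?n2) = \<delta> ^ 5 * ?n2" by (simp add: eval_nat_numeral)
        moreover have "real (Suc j) * \<delta> ^ 5 * ?n2 = real j * \<delta> ^ 5 * ?n2 + \<delta> ^ 5 * ?n2"
          by (simp add: algebra_simps)
        ultimately have "real (Suc j) * \<delta> ^ 5 * ?n2 \<le> energy V E S'"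
          using S'(3) S(3) by linarith
        then show ?thesis using c S'(1) by blast
      qed
    qed
  qed
  have "\<not> real k * \<delta> ^ 5 * ?n2 \<le> energy V E S" for S
    using energy_le[OF fV, of E S] mult_strict_right_mono[OF k n2] by linarith
  then show ?thesis using step[of k] by blast
qed

section \<open>Approximate homomorphisms into graphs of bounded size\<close>

lemma triangleI:
  assumes "simple_graph V E" "{a,b} \<in> E" "{a,c} \<in> E" "{b,c} \<in> E"
  shows "{a,b,c} \<in> triangles V E"
proof -
  have "{a,b} \<in> [V]\<^bsup>2\<^esup>" "{a,c} \<in> [V]\<^bsup>2\<^esup>" "{b,c} \<in> [V]\<^bsup>2\<^esup>"
    using assms unfolding simple_graph_def by (meson subsetD)+
  then have V: "a \<in> V" "b \<in> V" "c \<in> V" "a \<noteq> b" "a \<noteq> c" "b \<noteq> c"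
    by simp_all
  then have "{a,b,c} \<in> [V]\<^bsup>3\<^esup>" by (simp add: nsets_def)
  moreover have "[{a,b,c}]\<^bsup>2\<^esup> \<subseteq> {{a,b},{a,c},{b,c}}" unfolding nsets_2_eq by blast
  ultimately show ?thesis using assms unfolding triangles_def by blast
qed

lemma triangleE:
  assumes "T \<in> triangles V E"
  obtains a b c where "T = {a,b,c}" "a \<noteq> b" "a \<noteq> c" "b \<noteq> c" "a \<in> V" "b \<in> V" "c \<in> V"
    "{a,b} \<in> E" "{a,c} \<in> E" "{b,c} \<in> E"
proof -
  from assms obtain a b c where T: "T = {a,b,c}" "a \<in> V" "b \<in> V" "c \<in> V" "a \<noteq> b" "a \<noteq> c" "b \<noteq> c"
    unfolding triangles_def nsets_3_eq by blast
  have "{a,b} \<in> [T]\<^bsup>2\<^esup>" "{a,c} \<in> [T]\<^bsup>2\<^esup>" "{b,c} \<in> [T]\<^bsup>2\<^esup>" using T by auto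
  then show thesis using that T assms unfolding triangles_def by blast
qed

text \<open>The reduced graph, whose vertices are the labels of the parts.\<close>

definition reduced_edges :: "'a set \<Rightarrow> 'a set set \<Rightarrow> real \<Rightarrow> 'a set set \<Rightarrow> 'a set set set set" where
  "reduced_edges V E \<delta> S = {{i, j} | i j. i \<in> label S ` V \<and> j \<in> label S ` V \<and> i \<noteq> j \<and>
     unif_dense E \<delta> (cell V S i) (cell V S j)}"

lemma simple_reduced: "finite V \<Longrightarrow> simple_graph (label S ` V) (reduced_edges V E \<delta> S)"
  by (auto simp: simple_graph_def reduced_edges_def)

lemma in_reduced_edges: "{i, j} \<in> reduced_edges V E \<delta> S \<longleftrightarrow> 
   i \<in> label S ` V \<and> j \<in> label S ` V \<and> i \<noteq> j \<and> unif_dense E \<delta> (cell V S i) (cell V S j)"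
  unfolding reduced_edges_def by (auto simp: doubleton_eq_iff unif_dense_commute)

lemma cells_no_dense_triangle:
  assumes G: "simple_graph V E" "triangle_free V E" and d: "0 < \<delta>" "\<delta> \<le> 1/2"
    and ijk: "i \<in> label S ` V" "j \<in> label S ` V" "k \<in> label S ` V"
    and D: "unif_dense E \<delta> (cell V S i) (cell V S j)" "unif_dense E \<delta> (cell V S i) (cell V S k)"
      "unif_dense E \<delta> (cell V S j) (cell V S k)"
  shows False
proof -
  have fin: "finite (cell V S l)" for l using G by (auto simp: simple_graph_def cell_def)
  have "cell V S i \<noteq> {}" "cell V S j \<noteq> {}" "cell V S k \<noteq> {}" using ijk by (auto simp: cell_def)
  then obtain a b c where "{a,b} \<in> E" "{a,c} \<in> E" "{b,c} \<in> E"
    using unif_dense_triangle[OF fin fin fin _ _ _ d D] by blast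
  then have "{a,b,c} \<in> triangles V E" by (rule triangleI[OF G(1)])
  then show False using G(2) by (simp add: triangle_free_def)
qed

lemma triangle_free_reduced:
  assumes G: "simple_graph V E" "triangle_free V E" and d: "0 < \<delta>" "\<delta> \<le> 1/2"
  shows "triangle_free (label S ` V) (reduced_edges V E \<delta> S)"
proof (unfold triangle_free_def, rule equals0I)
  fix T assume "T \<in> triangles (label S ` V) (reduced_edges V E \<delta> S)"
  then obtain i j k where "{i,j} \<in> reduced_edges V E \<delta> S" "{i,k} \<in> reduced_edges V E \<delta> S"
    "{j,k} \<in> reduced_edges V E \<delta> S" by (rule triangleE)
  then show False unfolding in_reduced_edges
    using cells_no_dense_triangle[OF G d] by blast
qed

text \<open>An edge is lost only if its parts do not form a uniformly dense pair, since an edge within a part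
that is uniformly dense with itself would come with a triangle. Such an edge lies in an
irregular pair, or in a pair of parts of density below \<open>2 * \<delta>\<close>; both kinds are few.\<close>

lemma approx_hom_reduced:
  assumes G: "simple_graph V E" "triangle_free V E" and d: "0 < \<delta>" "\<delta> \<le> 1/2"
    and irr: "card (irregular V E \<delta> S) \<le> \<delta> * (real (card V))\<^sup>2"
  shows "approx_hom (3 * \<delta>) V E (label S ` V) (reduced_edges V E \<delta> S) (label S)"
proof -
  have fV: "finite V" and EV: "E \<subseteq> [V]\<^bsup>2\<^esup>" using G by (auto simp: simple_graph_def)
  let ?Om = "V \<times> V"
  have fOm: "finite ?Om" using fV by simp
  define lost where "lost = {e \<in> E. label S ` e \<notin> reduced_edges V E \<delta> S}"
  define sparse where "sparse = {w\<in>?Om. {fst w, snd w} \<in> E \<and> density V E S w < 2 * \<delta>}"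
  have "lost \<subseteq> (\<lambda>w. {fst w, snd w}) ` (sparse \<union> irregular V E \<delta> S)"
  proof
    fix e assume e: "e \<in> lost"
    then obtain x y where xy: "e = {x,y}" "x \<in> V" "y \<in> V"
      using EV by (auto simp: lost_def elim!: nsets2_E)
    let ?i = "label S x" and ?j = "label S y"
    have "\<not> unif_dense E \<delta> (cell V S ?i) (cell V S ?j)"
    proof
      assume D: "unif_dense E \<delta> (cell V S ?i) (cell V S ?j)"
      show False
      proof (cases "?i = ?j")
        case True
        show False
          by (rule cells_no_dense_triangle[OF G d, of ?i S ?i ?i]) (use D True xy in auto)
      next
        case False
        then have "{?i, ?j} \<in> reduced_edges V E \<delta> S" using D xy by (auto simp: in_reduced_edges)
        then show False using e xy by (auto simp: lost_def)
      qed
    qed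
    then have "(x,y) \<in> sparse \<union> irregular V E \<delta> S" using e xy
      by (auto simp: sparse_def irregular_def lost_def)
    then show "e \<in> (\<lambda>w. {fst w, snd w}) ` (sparse \<union> irregular V E \<delta> S)"
      using xy(1) by (intro image_eqI[of _ _ "(x,y)"]) auto
  qed
  moreover have fin: "finite sparse" "finite (irregular V E \<delta> S)"
    using fOm by (auto simp: sparse_def irregular_def)
  ultimately have "card lost \<le> card (sparse \<union> irregular V E \<delta> S)"
    by (meson finite_UnI surj_card_le)
  also have "\<dots> \<le> card sparse + card (irregular V E \<delta> S)" by (rule card_Un_le)
  finally have 1: "real (card lost) \<le> card sparse + card (irregular V E \<delta> S)" by linarith
  let ?g = "\<lambda>w. of_bool (density V E S w < 2 * \<delta>) :: real"
  have "real (card sparse) = (\<Sum>w\<in>sparse. 1)" by simp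
  also have "\<dots> = (\<Sum>w\<in>sparse. adj E w * ?g w)" by (rule sum.cong) (auto simp: sparse_def adj_def)
  also have "\<dots> = (\<Sum>w\<in>?Om. adj E w * ?g w)"
    by (rule sum.mono_neutral_left[OF fOm]) (auto simp: sparse_def adj_def)
  also have "\<dots> = (\<Sum>w\<in>?Om. density V E S w * ?g w)"
    unfolding density_def by (rule sum_cond_avg_mult[OF fOm, symmetric]) (metis cond_avg_cong)
  also have "\<dots> \<le> (\<Sum>w\<in>?Om. 2 * \<delta>)" by (rule sum_mono) (use d in auto)
  also have "\<dots> = 2 * \<delta> * (real (card V))\<^sup>2" by (simp add: card_cartesian_product power2_eq_square)
  finally show ?thesis using 1 irr by (simp add: approx_hom_def lost_def)
qed

text \<open>The property of \<open>M\<close> that \<open>M_TFL \<epsilon>\<close> minimises.\<close>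

definition TFL_bound :: "real \<Rightarrow> nat \<Rightarrow> bool" where
  "TFL_bound \<epsilon> M \<longleftrightarrow> (\<forall>(V\<^sub>G :: nat set) E\<^sub>G. simple_graph V\<^sub>G E\<^sub>G \<and> triangle_free V\<^sub>G E\<^sub>G \<longrightarrow>
       (\<exists>(V\<^sub>F :: nat set) E\<^sub>F \<phi>. simple_graph V\<^sub>F E\<^sub>F \<and> triangle_free V\<^sub>F E\<^sub>F \<and> card V\<^sub>F \<le> M \<and>
          approx_hom \<epsilon> V\<^sub>G E\<^sub>G V\<^sub>F E\<^sub>F \<phi>))"

text \<open>Together with the next lemma, this allows graphs over arbitrary vertex types to be exchanged with
graphs on the natural numbers.\<close>

lemma image_graph:
  assumes inj: "inj_on g V" and G: "simple_graph V E"
  shows "simple_graph (g ` V) ((`) g ` E)" 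
    and "triangle_free V E \<Longrightarrow> triangle_free (g ` V) ((`) g ` E)"
    and "e \<subseteq> V \<Longrightarrow> g ` e \<in> (`) g ` E \<longleftrightarrow> e \<in> E"
proof -
  have EV: "e \<subseteq> V" if "e \<in> E" for e using G that by (auto simp: simple_graph_def nsets_def)
  have mem: "g ` e \<in> (`) g ` E \<longleftrightarrow> e \<in> E" if "e \<subseteq> V" for e
    using inj_on_image_eq_iff[OF inj that EV] by auto
  then show "e \<subseteq> V \<Longrightarrow> g ` e \<in> (`) g ` E \<longleftrightarrow> e \<in> E" .
  have "card (g ` e) = card e" if "e \<in> E" for e
    using inj EV[OF that] by (meson card_image inj_on_subset)
  then show "simple_graph (g ` V) ((`) g ` E)"
    using G EV by (fastforce simp: simple_graph_def nsets_def)
  assume tf: "triangle_free V E"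
  show "triangle_free (g ` V) ((`) g ` E)"
  proof (unfold triangle_free_def, rule equals0I)
    fix T assume "T \<in> triangles (g ` V) ((`) g ` E)"
    then obtain a b c where "a \<in> g ` V" "b \<in> g ` V" "c \<in> g ` V"
      and e: "{a,b} \<in> (`) g ` E" "{a,c} \<in> (`) g ` E" "{b,c} \<in> (`) g ` E"
      by (rule triangleE)
    then obtain x y z where xyz: "x \<in> V" "y \<in> V" "z \<in> V" "a = g x" "b = g y" "c = g z" by blast
    have "{x,y} \<in> E" "{x,z} \<in> E" "{y,z} \<in> E"
      using e mem[of "{x,y}"] mem[of "{x,z}"] mem[of "{y,z}"] xyz by auto
    then have "{x,y,z} \<in> triangles V E" by (rule triangleI[OF G])
    with tf show False by (simp add: triangle_free_def)
  qed
qed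

lemma approx_hom_image:
  assumes inj: "inj_on g V'" and F: "simple_graph V' E'" and G: "simple_graph V E"
    and h: "approx_hom \<epsilon> V E V' E' \<phi>"
  shows "approx_hom \<epsilon> V E (g ` V') ((`) g ` E') (g \<circ> \<phi>)"
proof -
  have "(g \<circ> \<phi>) ` e \<in> (`) g ` E' \<longleftrightarrow> \<phi> ` e \<in> E'" if "e \<in> E" for e
  proof -
    have "\<phi> ` e \<subseteq> V'" using that G h by (auto simp: simple_graph_def nsets_def approx_hom_def)
    from image_graph(3)[OF inj F this] show ?thesis by (simp add: image_comp)
  qed
  then have "{e \<in> E. (g \<circ> \<phi>) ` e \<notin> (`) g ` E'} = {e \<in> E. \<phi> ` e \<notin> E'}" by blast
  then show ?thesis using h by (auto simp: approx_hom_def)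
qed

text \<open>The triangle-free lemma, which makes \<open>M_TFL \<epsilon>\<close> an attained minimum.\<close>

lemma ex_TFL_bound:
  assumes "\<epsilon> > 0" shows "\<exists>M. TFL_bound \<epsilon> M"
proof -
  define \<delta> where "\<delta> = min (\<epsilon> / 3) (1 / 2)"
  have d: "0 < \<delta>" "\<delta> \<le> 1/2" "3 * \<delta> \<le> \<epsilon>" using assms by (auto simp: \<delta>_def)
  obtain k :: nat where "1 / \<delta> ^ 5 < k" using reals_Archimedean2 by blast
  then have k: "1 < real k * \<delta> ^ 5" using d by (simp add: field_simps)
  have "TFL_bound \<epsilon> (2 ^ complexity_bound k)"
    unfolding TFL_bound_def
  proof (intro allI impI, elim conjE)
    fix V :: "nat set" and E assume G: "simple_graph V E" "triangle_free V E"
    then have fV: "finite V" by (simp add: simple_graph_def)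
    obtain S where S: "finite S" "card S \<le> complexity_bound k"
      "card (irregular V E \<delta> S) \<le> \<delta> * (real (card V))\<^sup>2"
      using few_irregular_pairs[OF fV d(1) k] by blast
    let ?F = "label S ` V" and ?EF = "reduced_edges V E \<delta> S"
    have sF: "simple_graph ?F ?EF" by (rule simple_reduced[OF fV])
    have "approx_hom (3 * \<delta>) V E ?F ?EF (label S)" by (rule approx_hom_reduced[OF G d(1,2) S(3)])
    moreover have "3 * \<delta> * (real (card V))\<^sup>2 \<le> \<epsilon> * (real (card V))\<^sup>2"
      using d by (intro mult_right_mono) auto
    ultimately have h: "approx_hom \<epsilon> V E ?F ?EF (label S)" by (simp add: approx_hom_def)
    have "finite ?F" using fV by simp
    then obtain g :: "nat set set \<Rightarrow> nat" where g: "inj_on g ?F"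
      using finite_imp_inj_to_nat_seg by blast
    have "card ?F \<le> 2 ^ card S" by (rule card_label_image_le[OF S(1)])
    also have "\<dots> \<le> 2 ^ complexity_bound k" using S(2) by (intro power_increasing) auto
    finally have "card (g ` ?F) \<le> 2 ^ complexity_bound k" using card_image[OF g] by simp
    then show "\<exists>(V\<^sub>F :: nat set) E\<^sub>F \<phi>. simple_graph V\<^sub>F E\<^sub>F \<and> triangle_free V\<^sub>F E\<^sub>F \<and>
        card V\<^sub>F \<le> 2 ^ complexity_bound k \<and> approx_hom \<epsilon> V E V\<^sub>F E\<^sub>F \<phi>"
      using image_graph(1)[OF g sF] image_graph(2)[OF g sF triangle_free_reduced[OF G d(1,2)]]
        approx_hom_image[OF g sF G(1) h] by blast
  qed
  then show ?thesis by blast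
qed

section \<open>Coordinates that a partition of the cube can determine\<close>

text \<open>The subsets of \<open>T\<close> are the points of the discrete cube, and \<open>\<phi>\<close> partitions them into classes
indexed by \<open>I\<close>.\<close>

definition bit_sign :: "'t \<Rightarrow> 't set \<Rightarrow> real" where
  "bit_sign t A = (if t \<in> A then 1 else -1)"

definition bias :: "'t set \<Rightarrow> ('t set \<Rightarrow> 'i) \<Rightarrow> 't \<Rightarrow> 'i \<Rightarrow> real" where
  "bias T \<phi> t i = (\<Sum>A\<in>{A\<in>Pow T. \<phi> A = i}. bit_sign t A)"

text \<open>The coordinates that the class of a random point predicts with substantial advantage over guessing:
the sum is the size of the cube times the expected absolute bias of the coordinate within a class.\<close>

definition determined :: "'t set \<Rightarrow> 'i set \<Rightarrow> ('t set \<Rightarrow> 'i) \<Rightarrow> 't set" where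
  "determined T I \<phi> = {t\<in>T. 2 ^ card T / 2 < (\<Sum>i\<in>I. \<bar>bias T \<phi> t i\<bar>)}"

lemma exp_sum_le:
  fixes x :: real assumes "0 \<le> x" "x \<le> 1"
  shows "exp x + exp (- x) \<le> 2 * exp (x\<^sup>2)"
proof -
  have "exp x \<le> 1 + x + x\<^sup>2" using exp_bound assms by simp
  moreover have "exp (- x) \<le> 1 - x + x\<^sup>2"
  proof -
    have "1 \<le> (1 - x + x\<^sup>2) * (1 + x)" using assms
      by (simp add: algebra_simps power2_eq_square)
    also have "\<dots> \<le> (1 - x + x\<^sup>2) * exp x"
      using assms by (intro mult_left_mono) auto
    finally show ?thesis by (simp add: exp_minus field_simps)
  qed
  moreover have "1 + x\<^sup>2 \<le> exp (x\<^sup>2)" by (rule exp_ge_add_one_self)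
  ultimately show ?thesis by linarith
qed

text \<open>The moment generating function of a sum of independent random signs factorises.\<close>

lemma cube_exp_moment:
  fixes \<sigma> :: "'t \<Rightarrow> real"
  assumes fT: "finite T" and U: "U \<subseteq> T" and sg: "\<And>t. \<sigma> t = 1 \<or> \<sigma> t = -1" and l: "0 \<le> l" "l \<le> 1"
  shows "(\<Sum>A\<in>Pow T. exp (l * (\<Sum>t\<in>U. \<sigma> t * bit_sign t A))) \<le> 2 ^ card T * exp (l\<^sup>2 * card U)"
proof -
  let ?f = "\<lambda>t. if t \<in> U then exp (l * \<sigma> t) else 1"
  let ?g = "\<lambda>t. if t \<in> U then exp (- (l * \<sigma> t)) else 1"
  have "exp (l * (\<Sum>t\<in>U. \<sigma> t * bit_sign t A)) = (\<Prod>t\<in>A. ?f t) * (\<Prod>t\<in>T - A. ?g t)"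
    if "A \<in> Pow T" for A
  proof -
    have fU: "finite U" using U fT by (rule finite_subset)
    have "exp (l * (\<Sum>t\<in>U. \<sigma> t * bit_sign t A)) = (\<Prod>t\<in>U. exp (l * (\<sigma> t * bit_sign t A)))"
      by (simp add: sum_distrib_left exp_sum[OF fU])
    also have "\<dots> = (\<Prod>t\<in>U. if t \<in> A then ?f t else ?g t)"
      by (rule prod.cong) (auto simp: bit_sign_def)
    also have "\<dots> = (\<Prod>t\<in>T. if t \<in> A then ?f t else ?g t)"
      by (rule prod.mono_neutral_left[OF fT U]) auto
    also have "\<dots> = (\<Prod>t\<in>A. if t \<in> A then ?f t else ?g t) * (\<Prod>t\<in>T - A. if t \<in> A then ?f t else ?g t)"
      using that fT by (metis (no_types, lifting) PowD mult.commute prod.subset_diff)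
    also have "(\<Prod>t\<in>A. if t \<in> A then ?f t else ?g t) = (\<Prod>t\<in>A. ?f t)" by (rule prod.cong) auto
    also have "(\<Prod>t\<in>T - A. if t \<in> A then ?f t else ?g t) = (\<Prod>t\<in>T - A. ?g t)" by (rule prod.cong) auto
    finally show ?thesis .
  qed
  then have "(\<Sum>A\<in>Pow T. exp (l * (\<Sum>t\<in>U. \<sigma> t * bit_sign t A)))
      = (\<Sum>A\<in>Pow T. (\<Prod>t\<in>A. ?f t) * (\<Prod>t\<in>T - A. ?g t))" by (rule sum.cong[OF refl])
  also have "\<dots> = (\<Prod>t\<in>T. ?f t + ?g t)" by (rule prod_add[OF fT, symmetric])
  also have "\<dots> \<le> (\<Prod>t\<in>T. 2 * (if t \<in> U then exp (l\<^sup>2) else 1))"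
  proof (rule prod_mono)
    fix t
    have "exp (l * \<sigma> t) + exp (- (l * \<sigma> t)) \<le> 2 * exp (l\<^sup>2)"
      using sg[of t] exp_sum_le[OF l] by auto
    then show "0 \<le> ?f t + ?g t \<and> ?f t + ?g t \<le> 2 * (if t \<in> U then exp (l\<^sup>2) else 1)"
      by (auto intro: add_nonneg_nonneg)
  qed
  also have "\<dots> = 2 ^ card T * (\<Prod>t\<in>T. if t \<in> U then exp (l\<^sup>2) else 1)"
    by (simp add: prod.distrib)
  also have "(\<Prod>t\<in>T. if t \<in> U then exp (l\<^sup>2) else 1) = (\<Prod>t\<in>U. exp (l\<^sup>2))"
    by (rule prod.mono_neutral_cong_right[OF fT U]) auto
  also have "\<dots> = exp (l\<^sup>2 * card U)" by (simp add: exp_of_nat_mult mult.commute)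
  finally show ?thesis .
qed

text \<open>An exponential-moment substitute for the subadditivity of entropy. Score a point by the number of
determined coordinates that agree with the majority in its class, minus the number of those that
disagree. The mean score is at least half the number of determined coordinates. On the other
hand, if the majorities are taken from one fixed class, the score is a sum of independent signs over
the whole cube and so has a small exponential moment. Summing over the classes costs a factor
\<open>card I\<close>, and Jensen's inequality compares the two bounds.\<close>

lemma card_determined_le:
  fixes \<phi> :: "'t set \<Rightarrow> 'i"
  assumes fT: "finite T" and fI: "finite I" and \<phi>: "\<phi> ` Pow T \<subseteq> I"
  shows "real (card (determined T I \<phi>)) \<le> 16 * ln (card I)"
proof -
  let ?U = "determined T I \<phi>"
  let ?N = "2 ^ card T :: real"
  let ?b = "real (card ?U)"
  have U: "?U \<subseteq> T" by (auto simp: determined_def)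
  have fU: "finite ?U" using U fT by (rule finite_subset)
  have fP: "finite (Pow T)" using fT by simp
  have cP: "real (card (Pow T)) = ?N" using fT by (simp add: card_Pow)
  define \<sigma> :: "'t \<Rightarrow> 'i \<Rightarrow> real" where "\<sigma> t i = (if bias T \<phi> t i \<ge> 0 then 1 else -1)" for t i
  have sg: "\<sigma> t i = 1 \<or> \<sigma> t i = -1" for t i by (simp add: \<sigma>_def)
  define f where "f A = (\<Sum>t\<in>?U. \<sigma> t (\<phi> A) * bit_sign t A)" for A
  have "?b * (?N / 2) = (\<Sum>t\<in>?U. ?N / 2)" by simp
  also have "\<dots> \<le> (\<Sum>t\<in>?U. \<Sum>i\<in>I. \<bar>bias T \<phi> t i\<bar>)"
    by (rule sum_mono) (auto simp: determined_def)
  also have "\<dots> = (\<Sum>t\<in>?U. \<Sum>A\<in>Pow T. \<sigma> t (\<phi> A) * bit_sign t A)"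
  proof (rule sum.cong[OF refl])
    fix t
    have "\<bar>bias T \<phi> t i\<bar> = (\<Sum>A\<in>{A\<in>Pow T. \<phi> A = i}. \<sigma> t (\<phi> A) * bit_sign t A)" for i
    proof -
      have "\<bar>bias T \<phi> t i\<bar> = \<sigma> t i * bias T \<phi> t i" by (simp add: \<sigma>_def)
      also have "\<dots> = (\<Sum>A\<in>{A\<in>Pow T. \<phi> A = i}. \<sigma> t (\<phi> A) * bit_sign t A)"
        unfolding bias_def sum_distrib_left by (rule sum.cong) auto
      finally show ?thesis .
    qed
    then show "(\<Sum>i\<in>I. \<bar>bias T \<phi> t i\<bar>) = (\<Sum>A\<in>Pow T. \<sigma> t (\<phi> A) * bit_sign t A)"
      using sum.group[OF fP fI \<phi>, of "\<lambda>A. \<sigma> t (\<phi> A) * bit_sign t A"] by simp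
  qed
  also have "\<dots> = (\<Sum>A\<in>Pow T. f A)" unfolding f_def by (rule sum.swap)
  finally have avg: "?b * (?N / 2) \<le> (\<Sum>A\<in>Pow T. f A)" .
  \<comment> \<open>Jensen's inequality for the exponential, in the form of its tangent at \<open>?b / 8\<close>,
    a lower bound for the mean of \<open>f / 4\<close>.\<close>
  have "?N * exp (?b / 8) \<le> exp (?b / 8) * (?N + (\<Sum>A\<in>Pow T. f A) / 4 - ?N * ?b / 8)"
    using avg by (simp add: mult.commute)
  also have "\<dots> = (\<Sum>A\<in>Pow T. exp (?b / 8) * (1 + (f A / 4 - ?b / 8)))"
    by (simp add: sum_distrib_left[symmetric] sum.distrib sum_subtractf sum_divide_distrib[symmetric] cP)
  also have "\<dots> \<le> (\<Sum>A\<in>Pow T. exp (f A / 4))"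
  proof (rule sum_mono)
    fix A
    have "exp (?b / 8) * (1 + (f A / 4 - ?b / 8)) \<le> exp (?b / 8) * exp (f A / 4 - ?b / 8)"
      by (intro mult_left_mono exp_ge_add_one_self) simp
    then show "exp (?b / 8) * (1 + (f A / 4 - ?b / 8)) \<le> exp (f A / 4)"
      by (simp add: exp_add[symmetric])
  qed
  also have "\<dots> = (\<Sum>i\<in>I. \<Sum>A\<in>{A\<in>Pow T. \<phi> A = i}. exp (f A / 4))"
    by (rule sum.group[OF fP fI \<phi>, symmetric])
  also have "\<dots> \<le> (\<Sum>i\<in>I. ?N * exp (?b / 16))"
  proof (rule sum_mono)
    fix i
    have "(\<Sum>A\<in>{A\<in>Pow T. \<phi> A = i}. exp (f A / 4))
        = (\<Sum>A\<in>{A\<in>Pow T. \<phi> A = i}. exp (1/4 * (\<Sum>t\<in>?U. \<sigma> t i * bit_sign t A)))"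
      by (rule sum.cong) (auto simp: f_def)
    also have "\<dots> \<le> (\<Sum>A\<in>Pow T. exp (1/4 * (\<Sum>t\<in>?U. \<sigma> t i * bit_sign t A)))"
      by (rule sum_mono2[OF fP]) auto
    also have "\<dots> \<le> ?N * exp ((1/4)\<^sup>2 * ?b)"
      by (rule cube_exp_moment[OF fT U sg]) auto
    finally show "(\<Sum>A\<in>{A\<in>Pow T. \<phi> A = i}. exp (f A / 4)) \<le> ?N * exp (?b / 16)"
      by (simp add: power2_eq_square)
  qed
  also have "\<dots> = ?N * (card I * exp (?b / 16))" by simp
  finally have "exp (?b / 8) \<le> card I * exp (?b / 16)" by simp
  moreover have "exp (?b / 8) = exp (?b / 16) * exp (?b / 16)" by (simp add: exp_add[symmetric])
  ultimately have e: "exp (?b / 16) \<le> card I" by simp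
  have "0 < real (card I)" using e by (meson exp_gt_zero less_le_trans)
  then have "?b / 16 \<le> ln (card I)" using e by (metis exp_gt_zero ln_exp ln_le_cancel_iff)
  then show ?thesis by simp
qed

text \<open>How many points of class \<open>i\<close> are available whichever value of the coordinate \<open>t\<close> is prescribed.\<close>

definition minority :: "'t set \<Rightarrow> ('t set \<Rightarrow> 'i) \<Rightarrow> 't \<Rightarrow> 'i \<Rightarrow> real" where
  "minority T \<phi> t i = min (real (card {A\<in>Pow T. \<phi> A = i \<and> t \<in> A}))
     (real (card {A\<in>Pow T. \<phi> A = i \<and> t \<notin> A}))"

lemma minority_nonneg: "0 \<le> minority T \<phi> t i"
  by (simp add: minority_def)

lemma minority_le: "minority T \<phi> t i \<le> real (card {A\<in>Pow T. \<phi> A = i \<and> (t \<in> A \<longleftrightarrow> b)})"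
  by (cases b) (simp_all add: minority_def)

lemma minority_eq:
  assumes "finite T"
  shows "2 * minority T \<phi> t i = real (card {A\<in>Pow T. \<phi> A = i}) - \<bar>bias T \<phi> t i\<bar>"
proof -
  let ?P = "{A\<in>Pow T. \<phi> A = i \<and> t \<in> A}" and ?Q = "{A\<in>Pow T. \<phi> A = i \<and> t \<notin> A}"
  have fin: "finite ?P" "finite ?Q" using assms by auto
  have un: "{A\<in>Pow T. \<phi> A = i} = ?P \<union> ?Q" and dis: "?P \<inter> ?Q = {}" by auto
  have "bias T \<phi> t i = (\<Sum>A\<in>?P. bit_sign t A) + (\<Sum>A\<in>?Q. bit_sign t A)"
    unfolding bias_def un by (rule sum.union_disjoint[OF fin dis])
  also have "\<dots> = real (card ?P) - real (card ?Q)" by (simp add: bit_sign_def)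
  finally have "bias T \<phi> t i = real (card ?P) - real (card ?Q)" .
  moreover have "card {A\<in>Pow T. \<phi> A = i} = card ?P + card ?Q"
    unfolding un by (rule card_Un_disjoint[OF fin dis])
  ultimately show ?thesis by (simp add: minority_def)
qed

lemma sum_minority:
  assumes fT: "finite T" and fI: "finite I" and \<phi>: "\<phi> ` Pow T \<subseteq> I" and t: "t \<in> T"
  shows "(\<Sum>i\<in>I. minority T \<phi> t i) \<le> 2 ^ card T / 2"
    and "t \<notin> determined T I \<phi> \<Longrightarrow> 2 ^ card T / 4 \<le> (\<Sum>i\<in>I. minority T \<phi> t i)"
proof -
  have "(\<Sum>i\<in>I. real (card {A\<in>Pow T. \<phi> A = i})) = (\<Sum>i\<in>I. \<Sum>A\<in>{A\<in>Pow T. \<phi> A = i}. 1)" by simp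
  also have "\<dots> = (\<Sum>A\<in>Pow T. 1)" using fT by (intro sum.group fI \<phi>) simp
  also have "\<dots> = 2 ^ card T" using fT by (simp add: card_Pow)
  finally have *: "(\<Sum>i\<in>I. real (card {A\<in>Pow T. \<phi> A = i})) = 2 ^ card T" .
  have *: "2 * (\<Sum>i\<in>I. minority T \<phi> t i) = 2 ^ card T - (\<Sum>i\<in>I. \<bar>bias T \<phi> t i\<bar>)"
    unfolding sum_distrib_left minority_eq[OF fT] sum_subtractf * ..
  moreover have "0 \<le> (\<Sum>i\<in>I. \<bar>bias T \<phi> t i\<bar>)" by (rule sum_nonneg) simp
  ultimately show "(\<Sum>i\<in>I. minority T \<phi> t i) \<le> 2 ^ card T / 2" by linarith
  assume "t \<notin> determined T I \<phi>"
  then have "(\<Sum>i\<in>I. \<bar>bias T \<phi> t i\<bar>) \<le> 2 ^ card T / 2" using t by (simp add: determined_def)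
  with * show "2 ^ card T / 4 \<le> (\<Sum>i\<in>I. minority T \<phi> t i)" by linarith
qed

text \<open>Every triple of indices contains a pair outside \<open>R\<close>; weigh the triples by \<open>a i * b j * c k\<close>.\<close>

lemma nontriangle_weight:
  fixes a b c :: "'i \<Rightarrow> real"
  assumes nn: "\<And>i. 0 \<le> a i" "\<And>i. 0 \<le> b i" "\<And>i. 0 \<le> c i"
    and R: "\<And>i j k. i \<in> I \<Longrightarrow> j \<in> I \<Longrightarrow> k \<in> I \<Longrightarrow> \<not> (R i j \<and> R i k \<and> R j k)"
  shows "sum a I * sum b I * sum c I \<le>
      (\<Sum>i\<in>I. \<Sum>j\<in>I. a i * b j * of_bool (\<not> R i j)) * sum c I
    + (\<Sum>i\<in>I. \<Sum>k\<in>I. a i * c k * of_bool (\<not> R i k)) * sum b I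
    + (\<Sum>j\<in>I. \<Sum>k\<in>I. b j * c k * of_bool (\<not> R j k)) * sum a I"
proof -
  have "sum a I * sum b I * sum c I = (\<Sum>i\<in>I. \<Sum>j\<in>I. \<Sum>k\<in>I. a i * b j * c k)"
    by (simp only: sum_distrib_left[symmetric] sum_distrib_right[symmetric])
  also have "\<dots> \<le> (\<Sum>i\<in>I. \<Sum>j\<in>I. \<Sum>k\<in>I. (a i * b j * of_bool (\<not> R i j)) * c k
      + (a i * c k * of_bool (\<not> R i k)) * b j + (b j * c k * of_bool (\<not> R j k)) * a i)"
  proof (intro sum_mono)
    fix i j k assume "i \<in> I" "j \<in> I" "k \<in> I"
    then have "\<not> R i j \<or> \<not> R i k \<or> \<not> R j k" using R by blast
    moreover have "0 \<le> a i * b j * c k" using nn by simp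
    ultimately show "a i * b j * c k \<le> (a i * b j * of_bool (\<not> R i j)) * c k
      + (a i * c k * of_bool (\<not> R i k)) * b j + (b j * c k * of_bool (\<not> R j k)) * a i"
      by (auto simp: mult_ac)
  qed
  also have "\<dots> = (\<Sum>i\<in>I. \<Sum>j\<in>I. \<Sum>k\<in>I. (a i * b j * of_bool (\<not> R i j)) * c k)
    + (\<Sum>i\<in>I. \<Sum>k\<in>I. \<Sum>j\<in>I. (a i * c k * of_bool (\<not> R i k)) * b j)
    + (\<Sum>j\<in>I. \<Sum>k\<in>I. \<Sum>i\<in>I. (b j * c k * of_bool (\<not> R j k)) * a i)"
  proof -
    have 1: "(\<Sum>i\<in>I. \<Sum>j\<in>I. \<Sum>k\<in>I. f i j k) = (\<Sum>i\<in>I. \<Sum>k\<in>I. \<Sum>j\<in>I. f i j k)" for f :: "'i \<Rightarrow> 'i \<Rightarrow> 'i \<Rightarrow> real"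
      by (intro sum.cong refl sum.swap)
    have "(\<Sum>i\<in>I. \<Sum>j\<in>I. \<Sum>k\<in>I. f i j k) = (\<Sum>j\<in>I. \<Sum>i\<in>I. \<Sum>k\<in>I. f i j k)" for f :: "'i \<Rightarrow> 'i \<Rightarrow> 'i \<Rightarrow> real"
      by (rule sum.swap)
    with 1 have 2: "(\<Sum>i\<in>I. \<Sum>j\<in>I. \<Sum>k\<in>I. f i j k) = (\<Sum>j\<in>I. \<Sum>k\<in>I. \<Sum>i\<in>I. f i j k)" for f :: "'i \<Rightarrow> 'i \<Rightarrow> 'i \<Rightarrow> real"
      by metis
    show ?thesis unfolding sum.distrib
      by (intro arg_cong2[where f="(+)"] refl 1 2)
  qed
  finally show ?thesis by (simp only: sum_distrib_left[symmetric] sum_distrib_right[symmetric])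
qed

section \<open>Splitting the triangles of a graph\<close>

text \<open>The graph \<open>(V, E)\<close>, whose set of triangles is \<open>T\<close>, is blown up by replacing each vertex \<open>v\<close> with the points
\<open>(v, A)\<close> for \<open>A \<subseteq> T\<close>. For a triangle \<open>t\<close> with vertices \<open>v\<close>, \<open>w\<close>, \<open>u\<close>, the edge between \<open>v\<close> and
\<open>w\<close> is retained only between those points over \<open>v\<close> and \<open>w\<close> that have prescribed values of the
coordinate \<open>t\<close>. The values are chosen such that the points over \<open>v\<close> used towards \<open>w\<close> are
complementary to those used towards \<open>u\<close>: the condition \<open>t \<in> A\<close> selects the points used
towards the larger of the two.\<close>

definition linked :: "'v::linorder set set \<Rightarrow> 'v \<times> 'v set set \<Rightarrow> 'v \<times> 'v set set \<Rightarrow> bool" where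
  "linked T p q \<longleftrightarrow> (\<exists>u. {fst p, fst q, u} \<in> T \<and>
     ({fst p, fst q, u} \<in> snd p \<longleftrightarrow> u < fst q) \<and> ({fst p, fst q, u} \<in> snd q \<longleftrightarrow> u < fst p))"

definition split_edges :: "'v::linorder set \<Rightarrow> 'v set set \<Rightarrow> ('v \<times> 'v set set) set set" where
  "split_edges V T = {{p, q} | p q. p \<in> V \<times> Pow T \<and> q \<in> V \<times> Pow T \<and> linked T p q}"

lemma linked_commute: "linked T p q = linked T q p"
  unfolding linked_def insert_commute[of "fst q" "fst p"] by blast

lemma in_split_edges:
  "{p, q} \<in> split_edges V T \<longleftrightarrow> p \<in> V \<times> Pow T \<and> q \<in> V \<times> Pow T \<and> linked T p q"
  unfolding split_edges_def by (auto simp: doubleton_eq_iff linked_commute)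

lemma triangle_distinct:
  assumes "{a, b, c} \<in> triangles V E"
  shows "a \<noteq> b" "a \<noteq> c" "b \<noteq> c"
proof -
  have "card {a,b,c} = 3" using assms by (simp add: triangles_def nsets_def)
  then show "a \<noteq> b" "a \<noteq> c" "b \<noteq> c" by (auto simp: card_insert_if split: if_splits)
qed

lemma triangle_edges:
  assumes "{a, b, c} \<in> triangles V E"
  shows "{a, b} \<in> E" "{a, c} \<in> E" "{b, c} \<in> E" "a \<in> V" "b \<in> V" "c \<in> V"
proof -
  have *: "[{a,b,c}]\<^bsup>2\<^esup> \<subseteq> E" "{a,b,c} \<subseteq> V" using assms by (auto simp: triangles_def nsets_def)
  then show "{a, b} \<in> E" "{a, c} \<in> E" "{b, c} \<in> E"
    using triangle_distinct[OF assms] by (auto intro!: subsetD[OF *(1)])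
  show "a \<in> V" "b \<in> V" "c \<in> V" using * by auto
qed

lemma unique_triangleD:
  assumes "unique_triangle_edges V E" "e \<in> E" "t \<in> triangles V E" "t' \<in> triangles V E" "e \<subseteq> t" "e \<subseteq> t'"
  shows "t = t'"
  using assms unfolding unique_triangle_edges_def by blast

lemma linked_edge:
  assumes "linked (triangles V E) p q" shows "{fst p, fst q} \<in> E"
proof -
  obtain u where "{fst p, fst q, u} \<in> triangles V E" using assms unfolding linked_def by blast
  then show ?thesis by (rule triangle_edges(1))
qed

lemma simple_split:
  assumes "finite V" "finite (triangles V E)"
  shows "simple_graph (V \<times> Pow (triangles V E)) (split_edges V (triangles V E))"
proof -
  have "p \<noteq> q" if l: "linked (triangles V E) p q" for p q
  proof -
    obtain u where "{fst p, fst q, u} \<in> triangles V E" using l unfolding linked_def by blast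
    from triangle_distinct(1)[OF this] show ?thesis by auto
  qed
  then show ?thesis using assms by (auto simp: simple_graph_def split_edges_def)
qed

text \<open>A triangle in the split graph projects to a triangle \<open>t\<close> of the original graph. By uniqueness, \<open>t\<close>
is the triangle that governs all three edges. Then the coordinate \<open>t\<close> of any of the three points
would need to have both values.\<close>

lemma triangle_free_split:
  fixes V :: "'v::linorder set"
  assumes uq: "unique_triangle_edges V E" and G: "simple_graph V E"
  shows "triangle_free (V \<times> Pow (triangles V E)) (split_edges V (triangles V E))"
proof (unfold triangle_free_def, rule equals0I)
  let ?T = "triangles V E"
  fix X assume "X \<in> triangles (V \<times> Pow ?T) (split_edges V ?T)"
  then obtain p q r where L: "linked ?T p q" "linked ?T p r" "linked ?T q r"
    by (rule triangleE) (auto simp: in_split_edges)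
  let ?t = "{fst p, fst q, fst r}"
  have e: "{fst p, fst q} \<in> E" "{fst p, fst r} \<in> E" "{fst q, fst r} \<in> E"
    using L by (auto intro: linked_edge)
  then have t: "?t \<in> ?T" by (rule triangleI[OF G])
  have th: "u = fst r" if "{fst p, fst q, u} \<in> ?T" for u
  proof -
    have "{fst p, fst q, u} = ?t" (is "?t' = _") by (rule unique_triangleD[OF uq e(1) that t]) auto
    moreover have "u \<in> ?t'" by simp
    ultimately have "u \<in> ?t" by (simp only:)
    then show ?thesis using triangle_distinct[OF that] by auto
  qed
  have th': "u = fst q" if "{fst p, fst r, u} \<in> ?T" for u
  proof -
    have "{fst p, fst r, u} = ?t" (is "?t' = _") by (rule unique_triangleD[OF uq e(2) that t]) auto
    moreover have "u \<in> ?t'" by simp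
    ultimately have "u \<in> ?t" by (simp only:)
    then show ?thesis using triangle_distinct[OF that] by auto
  qed
  have "?t \<in> snd p \<longleftrightarrow> fst r < fst q" using L(1) th unfolding linked_def by blast
  moreover have "{fst p, fst r, fst q} \<in> snd p \<longleftrightarrow> fst q < fst r"
    using L(2) th' unfolding linked_def by blast
  moreover have "{fst p, fst r, fst q} = ?t" by auto
  ultimately show False using triangle_distinct[OF t] by auto
qed

definition lost_edges :: "'a set set \<Rightarrow> 'b set set \<Rightarrow> ('a \<Rightarrow> 'b) \<Rightarrow> 'a set set" where
  "lost_edges E E' \<phi> = {e\<in>E. \<phi> ` e \<notin> E'}"

text \<open>If the classes \<open>i\<close> and \<open>j\<close> are not adjacent in the target graph, all edges between points of class
\<open>i\<close> over \<open>x\<close> and points of class \<open>j\<close> over \<open>y\<close> are lost. Whatever coordinate values the edges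
prescribe, at least the minorities provide such points.\<close>

lemma lost_between:
  fixes V :: "'v::linorder set" and \<phi> :: "'v \<times> 'v set set \<Rightarrow> 'i"
  assumes fT: "finite T" and fI: "finite I" and fV: "finite V"
    and xy: "x \<in> V" "y \<in> V" "x \<noteq> y" and t: "{x,y,z} \<in> T"
  shows "(\<Sum>i\<in>I. \<Sum>j\<in>I. minority T (\<lambda>A. \<phi> (x,A)) {x,y,z} i * minority T (\<lambda>A. \<phi> (y,A)) {x,y,z} j
        * of_bool ({i,j} \<notin> EF))
    \<le> card {e\<in>lost_edges (split_edges V T) EF \<phi>. fst ` e = {x,y}}" (is "?S \<le> real (card ?L)")
proof -
  let ?t = "{x,y,z}"
  let ?X = "\<lambda>i. {A\<in>Pow T. \<phi> (x,A) = i \<and> (?t \<in> A \<longleftrightarrow> z < y)}"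
  let ?Y = "\<lambda>j. {A\<in>Pow T. \<phi> (y,A) = j \<and> (?t \<in> A \<longleftrightarrow> z < x)}"
  let ?J = "{w\<in>I \<times> I. {fst w, snd w} \<notin> EF}"
  let ?B = "\<lambda>w. ?X (fst w) \<times> ?Y (snd w)"
  let ?m = "\<lambda>w. minority T (\<lambda>A. \<phi> (x,A)) ?t (fst w) * minority T (\<lambda>A. \<phi> (y,A)) ?t (snd w)"
  have fJ: "finite ?J" using fI by simp
  have fB: "finite (?B w)" for w using fT by simp
  have "?S = (\<Sum>w\<in>I \<times> I. ?m w * of_bool ({fst w, snd w} \<notin> EF))"
    by (simp add: sum.cartesian_product case_prod_beta)
  also have "\<dots> = (\<Sum>w\<in>?J. ?m w)"
    using fI by (intro sum.mono_neutral_cong_right) auto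
  also have "\<dots> \<le> (\<Sum>w\<in>?J. real (card (?B w)))"
    unfolding card_cartesian_product of_nat_mult
    by (intro sum_mono mult_mono minority_le minority_nonneg of_nat_0_le_iff)
  also have "\<dots> = real (card (\<Union>w\<in>?J. ?B w))"
    by (subst card_UN_disjoint[OF fJ]) (use fB in auto)
  also have "\<dots> \<le> real (card ?L)"
  proof -
    let ?h = "\<lambda>(A, B). {(x, A), (y, B)}"
    have inj: "inj_on ?h (\<Union>w\<in>?J. ?B w)"
      using xy by (auto simp: inj_on_def doubleton_eq_iff)
    have sub: "?h ` (\<Union>w\<in>?J. ?B w) \<subseteq> ?L"
    proof
      fix e assume "e \<in> ?h ` (\<Union>w\<in>?J. ?B w)"
      then obtain A B where e: "e = {(x,A), (y,B)}" and A: "A \<in> Pow T" "?t \<in> A \<longleftrightarrow> z < y"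
        and B: "B \<in> Pow T" "?t \<in> B \<longleftrightarrow> z < x" and n: "{\<phi> (x,A), \<phi> (y,B)} \<notin> EF" by auto
      have "linked T (x,A) (y,B)" unfolding linked_def using t A B by auto
      then have "e \<in> split_edges V T" unfolding e in_split_edges using A B xy by auto
      then show "e \<in> ?L" using e n by (auto simp: lost_edges_def)
    qed
    have "?L \<subseteq> Pow (V \<times> Pow T)"
      unfolding lost_edges_def split_edges_def by auto
    then have "finite ?L" using fV fT by (meson finite_Pow_iff finite_SigmaI finite_subset)
    then show ?thesis using card_inj_on_le[OF inj sub] by simp
  qed
  finally show ?thesis .
qed

text \<open>If no map \<open>\<phi> (v, _)\<close> with \<open>v \<in> t\<close> determines the coordinate \<open>t\<close>, the minorities make up a quarter of the points
over each vertex of \<open>t\<close>. The target graph has no triangle, so between two of the vertices a constant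
proportion of the pairs of classes, weighted by their minorities, is not adjacent, and the corresponding edges are lost.\<close>

lemma lost_in_triangle:
  fixes V :: "'v::linorder set" and \<phi> :: "'v \<times> 'v set set \<Rightarrow> 'i"
  assumes fT: "finite T" and fV: "finite V" and F: "simple_graph I EF" "triangle_free I EF"
    and \<phi>: "\<phi> ` (V \<times> Pow T) \<subseteq> I" and t: "t \<in> T" and T: "T = triangles V E"
    and good: "\<And>v. v \<in> t \<Longrightarrow> t \<notin> determined T I (\<lambda>A. \<phi> (v, A))"
  shows "(2 ^ card T)\<^sup>2 / 96 \<le> real (card {e\<in>lost_edges (split_edges V T) EF \<phi>. fst ` e \<subseteq> t})"
    (is "_ \<le> real (card ?L)")
proof -
  let ?N = "2 ^ card T :: real"
  have fI: "finite I" using F by (simp add: simple_graph_def)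
  obtain x y z where xyz: "t = {x,y,z}" "x \<noteq> y" "x \<noteq> z" "y \<noteq> z" "x \<in> V" "y \<in> V" "z \<in> V"
    using triangleE t unfolding T by metis
  let ?mu = "\<lambda>v. minority T (\<lambda>A. \<phi> (v,A)) t"
  define S where "S v w = (\<Sum>i\<in>I. \<Sum>j\<in>I. ?mu v i * ?mu w j * of_bool ({i,j} \<notin> EF))" for v w
  have "?L \<subseteq> Pow (V \<times> Pow T)"
    unfolding lost_edges_def split_edges_def by auto
  then have fL: "finite ?L" using fV fT by (meson finite_Pow_iff finite_SigmaI finite_subset)
  have loss: "S v w \<le> card ?L" if "v \<in> V" "w \<in> V" "v \<noteq> w" "t = {v,w,u}" for v w u
  proof -
    have "S v w \<le> card {e\<in>lost_edges (split_edges V T) EF \<phi>. fst ` e = {v,w}}"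
      unfolding S_def using lost_between[OF fT fI fV that(1-3), of u \<phi> EF] t that(4) by simp
    also have "\<dots> \<le> card ?L"
      using that(4) by (intro of_nat_mono card_mono fL) auto
    finally show ?thesis .
  qed
  have l: "S x y \<le> card ?L" "S x z \<le> card ?L" "S y z \<le> card ?L"
    using loss[of x y z] loss[of x z y] loss[of y z x] xyz by (simp_all add: insert_commute)
  have hv: "(\<lambda>A. \<phi> (v,A)) ` Pow T \<subseteq> I" if "v \<in> V" for v using \<phi> that by auto
  have up: "sum (?mu v) I \<le> ?N / 2" if "v \<in> V" for v by (rule sum_minority(1)[OF fT fI hv[OF that] t])
  have lo: "?N / 4 \<le> sum (?mu v) I" if "v \<in> t" "v \<in> V" for v
    by (rule sum_minority(2)[OF fT fI hv[OF that(2)] t good[OF that(1)]])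
  have mu0: "0 \<le> sum (?mu v) I" for v by (intro sum_nonneg minority_nonneg)
  have "?N / 4 * (?N / 4) * (?N / 4) \<le> sum (?mu x) I * sum (?mu y) I * sum (?mu z) I"
    using lo xyz by (intro mult_mono mu0 mult_nonneg_nonneg) auto
  also have "\<dots> \<le> S x y * sum (?mu z) I + S x z * sum (?mu y) I + S y z * sum (?mu x) I"
    unfolding S_def
  proof (rule nontriangle_weight)
    fix i j k assume "i \<in> I" "j \<in> I" "k \<in> I"
    show "\<not> ({i,j} \<in> EF \<and> {i,k} \<in> EF \<and> {j,k} \<in> EF)"
      using triangleI[OF F(1), of i j k] F(2) unfolding triangle_free_def by blast
  qed (rule minority_nonneg)+
  also have "\<dots> \<le> real (card ?L) * (?N / 2) + real (card ?L) * (?N / 2) + real (card ?L) * (?N / 2)"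
    using l up xyz by (intro add_mono mult_mono mu0) auto
  \<comment> \<open>Altogether \<open>(?N / 4) ^ 3 \<le> 3 * card ?L * (?N / 2)\<close>, which is where 96 comes from.\<close>
  finally have "?N * (?N * ?N) \<le> ?N * (96 * real (card ?L))" by (simp add: field_simps)
  then have "?N * ?N \<le> 96 * real (card ?L)" by (subst (asm) mult_le_cancel_left_pos) simp_all
  then show ?thesis by (simp add: power2_eq_square)
qed

section \<open>The lower bound\<close>

lemma TFL_boundD:
  fixes V :: "'a set"
  assumes M: "TFL_bound \<epsilon> M" and G: "simple_graph V E" "triangle_free V E"
  obtains VF :: "nat set" and EF \<phi> where "simple_graph VF EF" "triangle_free VF EF" "card VF \<le> M"
    "approx_hom \<epsilon> V E VF EF \<phi>"
proof -
  have "finite V" using G by (simp add: simple_graph_def)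
  from finite_imp_inj_to_nat_seg[OF this]
  obtain g :: "'a \<Rightarrow> nat" where g: "inj_on g V" by auto
  let ?V = "g ` V" and ?E = "(`) g ` E"
  obtain VF :: "nat set" and EF \<phi> where F: "simple_graph VF EF" "triangle_free VF EF" "card VF \<le> M"
    and h: "approx_hom \<epsilon> ?V ?E VF EF \<phi>"
    using M image_graph(1)[OF g G(1)] image_graph(2)[OF g G] unfolding TFL_bound_def by blast
  have EV: "E \<subseteq> Pow V" using G by (auto simp: simple_graph_def nsets_def)
  have fE: "finite E" using finite_subset[OF EV] \<open>finite V\<close> by simp
  have "inj_on ((`) g) E" using inj_on_image_Pow[OF g] EV by (rule inj_on_subset)
  then have "inj_on ((`) g) {e\<in>E. (\<phi> \<circ> g) ` e \<notin> EF}" by (rule inj_on_subset) auto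
  moreover have "(`) g ` {e\<in>E. (\<phi> \<circ> g) ` e \<notin> EF} \<subseteq> {e\<in>?E. \<phi> ` e \<notin> EF}" by (auto simp: image_comp)
  ultimately have "card {e\<in>E. (\<phi> \<circ> g) ` e \<notin> EF} \<le> card {e\<in>?E. \<phi> ` e \<notin> EF}"
    using fE by (intro card_inj_on_le) auto
  then have "real (card {e\<in>E. (\<phi> \<circ> g) ` e \<notin> EF}) \<le> \<epsilon> * (real (card ?V))\<^sup>2"
    using h unfolding approx_hom_def by linarith
  then have "approx_hom \<epsilon> V E VF EF (\<phi> \<circ> g)"
    using h card_image[OF g] by (auto simp: approx_hom_def image_comp)
  then show thesis using that F by blast
qed

lemma TFL_bound_ge_1:
  assumes "TFL_bound \<epsilon> M" shows "1 \<le> M"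
proof -
  have G: "simple_graph {0::nat} {}" by (simp add: simple_graph_def)
  have tf: "triangle_free {0::nat} {}"
    unfolding triangle_free_def by (rule equals0I) (erule triangleE, simp)
  obtain VF :: "nat set" and EF \<phi> where F: "simple_graph VF EF" "card VF \<le> M"
    and h: "approx_hom \<epsilon> {0::nat} {} VF EF \<phi>" using TFL_boundD[OF assms G tf] .
  have "finite VF" using F by (simp add: simple_graph_def)
  moreover have "\<phi> 0 \<in> VF" using h by (simp add: approx_hom_def)
  ultimately have "0 < card VF" by (auto simp: card_gt_0_iff)
  then show ?thesis using F(2) by linarith
qed

text \<open>Apply the bound \<open>M\<close> to the split graph. For each vertex \<open>v\<close> at most \<open>16 * ln M\<close> coordinates are
determined, and each of the other triangles, those determined at none of their vertices, loses a
constant proportion of its edges. Since no edge of \<open>(V, E)\<close> is in two triangles, these losses concern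
disjoint sets of edges and add up to at most the permitted total, which limits the number of
these triangles. Every edge is in one of the triangles, whence \<open>card E \<le> 3 * card T\<close>.\<close>

lemma unique_triangle_edge_bound:
  fixes V :: "'v::linorder set"
  assumes M: "TFL_bound \<epsilon> M" and G: "simple_graph V E" and uq: "unique_triangle_edges V E"
    and ne: "V \<noteq> {}"
  shows "real (card E) \<le> 288 * \<epsilon> * (real (card V))\<^sup>2 + 48 * real (card V) * ln M"
proof -
  define T where "T = triangles V E"
  let ?N = "2 ^ card T :: real" and ?n = "real (card V)"
  have fV: "finite V" using G by (simp add: simple_graph_def)
  have fT: "finite T" using finite_imp_finite_nsets[OF fV, of 3] by (auto simp: T_def triangles_def)
  have sG: "simple_graph (V \<times> Pow T) (split_edges V T)"
    using simple_split fV fT unfolding T_def by blast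
  have tG: "triangle_free (V \<times> Pow T) (split_edges V T)"
    using triangle_free_split[OF uq G] unfolding T_def .
  obtain I :: "nat set" and EF \<phi> where F: "simple_graph I EF" "triangle_free I EF" and I: "card I \<le> M"
    and h: "approx_hom \<epsilon> (V \<times> Pow T) (split_edges V T) I EF \<phi>"
    using TFL_boundD[OF M sG tG] .
  have fI: "finite I" using F by (simp add: simple_graph_def)
  have \<phi>: "\<phi> ` (V \<times> Pow T) \<subseteq> I" using h by (simp add: approx_hom_def)
  then have "I \<noteq> {}" using ne by auto
  then have cI: "0 < card I" using fI by (simp add: card_gt_0_iff)
  let ?D = "\<lambda>v. determined T I (\<lambda>A. \<phi> (v, A))"
  let ?bad = "\<Union>v\<in>V. ?D v"
  let ?lost = "lost_edges (split_edges V T) EF \<phi>"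
  have "real (card ?bad) \<le> (\<Sum>v\<in>V. real (card (?D v)))"
    unfolding of_nat_sum[symmetric] by (intro of_nat_mono card_UN_le fV)
  also have "\<dots> \<le> (\<Sum>v\<in>V. 16 * ln M)"
  proof (rule sum_mono)
    fix v assume "v \<in> V"
    then have "real (card (?D v)) \<le> 16 * ln (card I)"
      using \<phi> by (intro card_determined_le fT fI) auto
    also have "\<dots> \<le> 16 * ln M" using I cI by simp
    finally show "real (card (?D v)) \<le> 16 * ln M" .
  qed
  finally have bad: "real (card ?bad) \<le> 16 * ?n * ln M" by simp
  let ?good = "T - ?bad"
  have fgood: "finite ?good" using fT by simp
  let ?L = "\<lambda>t. {e\<in>?lost. fst ` e \<subseteq> t}"
  have flost: "finite ?lost"
  proof -
    have "?lost \<subseteq> Pow (V \<times> Pow T)" unfolding lost_edges_def split_edges_def by auto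
    then show ?thesis using fV fT by (meson finite_Pow_iff finite_SigmaI finite_subset)
  qed
  have disj: "?L t \<inter> ?L t' = {}" if "t \<in> T" "t' \<in> T" "t \<noteq> t'" for t t'
  proof (rule equals0I)
    fix e assume e: "e \<in> ?L t \<inter> ?L t'"
    then obtain p q where pq: "e = {p,q}" "linked T p q" by (auto simp: lost_edges_def split_edges_def)
    then have "{fst p, fst q} \<in> E" unfolding T_def by (intro linked_edge)
    then have "t = t'" using unique_triangleD[OF uq] that e pq unfolding T_def by auto
    with that show False by simp
  qed
  have "real (card ?good) * (?N\<^sup>2 / 96) = (\<Sum>t\<in>?good. ?N\<^sup>2 / 96)" by simp
  also have "\<dots> \<le> (\<Sum>t\<in>?good. real (card (?L t)))"
  proof (rule sum_mono)
    fix t assume t: "t \<in> ?good"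
    then have "t \<subseteq> V" unfolding T_def triangles_def nsets_def by auto
    with t show "?N\<^sup>2 / 96 \<le> real (card (?L t))"
      by (intro lost_in_triangle[OF fT fV F \<phi> _ T_def]) auto
  qed
  also have "\<dots> = real (card (\<Union>t\<in>?good. ?L t))"
    by (subst card_UN_disjoint[OF fgood]) (use flost disj in auto)
  also have "\<dots> \<le> real (card ?lost)" by (intro of_nat_mono card_mono flost) auto
  also have "\<dots> \<le> \<epsilon> * (real (card (V \<times> Pow T)))\<^sup>2"
    using h by (simp add: approx_hom_def lost_edges_def)
  also have "\<dots> = 96 * \<epsilon> * ?n\<^sup>2 * (?N\<^sup>2 / 96)"
    using fT by (simp add: card_cartesian_product card_Pow power_mult_distrib)
  finally have good: "real (card ?good) \<le> 96 * \<epsilon> * ?n\<^sup>2"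
    by (subst (asm) mult_le_cancel_right_pos) auto
  have "E \<subseteq> (\<Union>t\<in>T. [t]\<^bsup>2\<^esup>)"
  proof
    fix e assume e: "e \<in> E"
    then obtain t where "t \<in> T" "e \<subseteq> t" using uq unfolding unique_triangle_edges_def T_def by blast
    moreover have "e \<in> [V]\<^bsup>2\<^esup>" using e G by (auto simp: simple_graph_def)
    ultimately show "e \<in> (\<Union>t\<in>T. [t]\<^bsup>2\<^esup>)" by (auto simp: nsets_def)
  qed
  moreover have ft: "finite t" "card t = 3" if "t \<in> T" for t using that by (auto simp: T_def triangles_def nsets_def)
  ultimately have "card E \<le> card (\<Union>t\<in>T. [t]\<^bsup>2\<^esup>)"
    by (intro card_mono) (use fT in \<open>auto intro: finite_imp_finite_nsets\<close>)
  also have "\<dots> \<le> (\<Sum>t\<in>T. card ([t]\<^bsup>2\<^esup>))" by (rule card_UN_le[OF fT])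
  also have "\<dots> = (\<Sum>t\<in>T. 3)" by (rule sum.cong) (simp_all add: ft choose_two)
  also have "\<dots> = 3 * card T" by simp
  finally have "card E \<le> 3 * card T" .
  moreover have "card T \<le> card ?good + card ?bad"
  proof -
    have "?bad \<subseteq> T" by (auto simp: determined_def)
    then have "T = ?good \<union> ?bad" by auto
    then show ?thesis by (metis card_Un_le)
  qed
  ultimately have "card E \<le> 3 * (card ?good + card ?bad)"
    by (meson mult_le_mono2 order_trans)
  then have "real (card E) \<le> real (3 * (card ?good + card ?bad))" by (rule of_nat_mono)
  then have "real (card E) \<le> 3 * (real (card ?good) + real (card ?bad))" by simp
  then show ?thesis using good bad by (simp add: algebra_simps)
qed

text \<open>By \<open>unique_triangle_edge_bound\<close>, a graph on \<open>n\<close> vertices that violates the bound defining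
\<open>N_DFL (400 * \<epsilon>)\<close> has \<open>2 * \<epsilon> * n \<le> ln (M_TFL \<epsilon>)\<close>. If \<open>N_DFL (400 * \<epsilon>)\<close> is
positive, its minimality provides such a graph with \<open>n \<ge> N_DFL (400 * \<epsilon>) - 1\<close>.\<close>

theorem theorem1p10:
  shows "\<exists>C>0. \<forall>\<epsilon>>0. real (M_TFL \<epsilon>) \<ge> exp (\<epsilon> * real (N_DFL (C * \<epsilon>)) / C)"
  \<comment> \<open>Any constant that exceeds 288 by at least \<open>2 * 48\<close> would do, see \<open>key\<close>.\<close>
proof (intro exI[of _ "400::real"] conjI allI impI)
  fix \<epsilon> :: real assume eps: "\<epsilon> > 0"
  let ?M = "M_TFL \<epsilon>"
  have M: "TFL_bound \<epsilon> ?M"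
  proof -
    have "?M = (LEAST M. TFL_bound \<epsilon> M)" unfolding M_TFL_def TFL_bound_def ..
    then show ?thesis using ex_TFL_bound[OF eps] by (metis LeastI_ex)
  qed
  have M1: "1 \<le> ?M" using TFL_bound_ge_1[OF M] .
  then have lnM: "0 \<le> ln ?M" by simp
  define P where "P N \<longleftrightarrow> (\<forall>n\<ge>N. \<forall>(V :: nat set) E.
       simple_graph V E \<and> card V = n \<and> unique_triangle_edges V E \<longrightarrow>
       real (card E) \<le> 400 * \<epsilon> * (real n)\<^sup>2)" for N
  have key: "2 * \<epsilon> * real n \<le> ln ?M"
    if V: "simple_graph V E" "card V = n" "unique_triangle_edges V E"
      and big: "\<not> real (card E) \<le> 400 * \<epsilon> * (real n)\<^sup>2" for n :: nat and V :: "nat set" and E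
  proof (cases "V = {}")
    case True
    then show ?thesis using V lnM by auto
  next
    case False
    then have n: "0 < real n" using V by (auto simp: simple_graph_def card_gt_0_iff)
    have "real (card E) \<le> 288 * \<epsilon> * (real n)\<^sup>2 + 48 * real n * ln ?M"
      using unique_triangle_edge_bound[OF M V(1,3) False] V(2) by simp
    with big have "112 * \<epsilon> * (real n)\<^sup>2 \<le> 48 * real n * ln ?M" by linarith
    then have "real n * (112 * \<epsilon> * real n) \<le> real n * (48 * ln ?M)"
      by (simp add: power2_eq_square mult_ac)
    then have "112 * \<epsilon> * real n \<le> 48 * ln ?M" using n by (subst (asm) mult_le_cancel_left_pos)
    moreover have "0 \<le> \<epsilon> * real n" using eps n by simp
    ultimately show ?thesis by linarith
  qed
  have "\<epsilon> * real (N_DFL (400 * \<epsilon>)) \<le> 400 * ln ?M"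
  proof -
    have N: "N_DFL (400 * \<epsilon>) = (LEAST N. P N)" unfolding N_DFL_def P_def ..
    show ?thesis
    proof (cases "N_DFL (400 * \<epsilon>)")
      case 0
      then show ?thesis using lnM by simp
    next
      case (Suc m)
      have "\<not> P m" using not_less_Least[of m P] Suc N by simp
      then obtain n V E where *: "simple_graph V E" "card (V::nat set) = n" "unique_triangle_edges V E"
        "\<not> real (card E) \<le> 400 * \<epsilon> * (real n)\<^sup>2" and nm: "m \<le> n" unfolding P_def by blast
      have "n \<noteq> 0"
      proof
        assume "n = 0"
        then have "V = {}" using * by (auto simp: simple_graph_def)
        then have "E = {}" using * by (auto simp: simple_graph_def nsets_def)
        with * show False using eps by simp
      qed
      \<comment> \<open>The offset by one in \<open>m \<le> n\<close> is absorbed by the factor 2, as \<open>n\<close> is positive.\<close>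
      then have "real (Suc m) \<le> 2 * real n" using nm by simp
      then have "\<epsilon> * real (Suc m) \<le> \<epsilon> * (2 * real n)" using eps by (intro mult_left_mono) auto
      also have "\<dots> \<le> ln ?M" using key[OF *] by simp
      also have "\<dots> \<le> 400 * ln ?M" using lnM by simp
      finally show ?thesis using Suc by simp
    qed
  qed
  then have "exp (\<epsilon> * real (N_DFL (400 * \<epsilon>)) / 400) \<le> exp (ln ?M)" by simp
  then show "exp (\<epsilon> * real (N_DFL (400 * \<epsilon>)) / 400) \<le> real ?M" using M1 by simp
qed simp

end
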